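(* Let $\alpha$ be a continuous rotationally symmetric norm on $L^\infty(\mathbb T)$ and let $f\in H^\alpha(\mathbb T)\subset H^1(\mathbb T)$. Suppose $\phi$ is an inner function and $g\in H^1(\mathbb T)$ is an outer function such that $f=\phi g$ (i.e. $f=\phi g$ is the Riesz–Smirnov inner-outer factorization of $f$ in $H^1(\mathbb T)$). Then $g\in H^\alpha(\mathbb T)$.
   Context: $\mathbb T$ is the unit circle and $m$ is normalized arc length (Haar measure) on $\mathbb T$; functions equal a.e. are identified. For $w\in\mathbb T$, $f_w(z)=f(\overline wz)$. A continuous rotationally symmetric norm is a norm $\alpha$ on $L^\infty(\mathbb T)$ with $\alpha(1)=1$, $\alpha(|f|)=\alpha(f)$, $\alpha(f_w)=\alpha(f)$ for all $f\in L^\infty(\mathbb T)$, $w\in\mathbb T$, and $\lim_{m(E)\to0^+}\alpha(\chi_E)=0$. For any measurable $f:\mathbb T\to\mathbb C$ put $\alpha(f)=\sup\{\alpha(s):s\text{ a simple function},\ |s|\le|f|\}$. $\mathcal L^\alpha(\mathbb T)$ is the set of measurable $f$ with $\alpha(f)<\infty$, and $L^\alpha(\mathbb T)$ is the $\alpha$-closure of $L^\infty(\mathbb T)$ in $\mathcal L^\alpha(\mathbb T)$. $H^\alpha(\mathbb T)$ is the $\alpha$-closed linear span of $\{1,z,z^2,\ldots\}$. An inner function is a member of $H^\infty(\mathbb T)$ that is unimodular a.e. on $\mathbb T$; $g\in H^1(\mathbb T)$ is outer if $H^\infty(\mathbb T)g$ is $\|\cdot\|_1$-dense in $H^1(\mathbb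 T)$. *)

theory Defs
  imports "HOL-Analysis.Analysis"
begin

(* Functions on the unit circle are modelled by functions complex => complex; only their values
   on the circle matter, since the circle is the whole space of the measure below.
   Instead of forming equivalence classes, everything is stated up to null sets. *)

definition unit_circle :: "complex set" where
  "unit_circle = sphere 0 1"

definition circle_measure :: "complex measure" where
  "circle_measure =
     distr (uniform_measure lborel {0..<2 * pi}) (restrict_space borel unit_circle) cis"

definition Linf_circle :: "(complex \<Rightarrow> complex) set" where
  "Linf_circle = {f \<in> borel_measurable circle_measure.
     \<exists>C. AE z in circle_measure. norm (f z) \<le> C}"

(* The first four conditions say that alpha is a norm on L^infinity. Well-definedness on
   a.e.-classes follows from the definiteness condition and the triangle inequality.
   Values of alpha outside L^infinity are irrelevant. *)

definition cont_rot_sym_norm :: "((complex \<Rightarrow> complex) \<Rightarrow> real) \<Rightarrow> bool" where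
  "cont_rot_sym_norm \<alpha> \<longleftrightarrow>
     (\<forall>f\<in>Linf_circle. 0 \<le> \<alpha> f) \<and>
     (\<forall>f\<in>Linf_circle. \<alpha> f = 0 \<longleftrightarrow> (AE z in circle_measure. f z = 0)) \<and>
     (\<forall>c. \<forall>f\<in>Linf_circle. \<alpha> (\<lambda>z. c * f z) = norm c * \<alpha> f) \<and>
     (\<forall>f\<in>Linf_circle. \<forall>g\<in>Linf_circle. \<alpha> (\<lambda>z. f z + g z) \<le> \<alpha> f + \<alpha> g) \<and>
     \<alpha> (\<lambda>z. 1) = 1 \<and>
     (\<forall>f\<in>Linf_circle. \<alpha> (\<lambda>z. of_real (norm (f z))) = \<alpha> f) \<and>
     (\<forall>w\<in>unit_circle. \<forall>f\<in>Linf_circle. \<alpha> (\<lambda>z. f (cnj w * z)) = \<alpha> f) \<and>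
     (\<forall>\<epsilon>>0. \<exists>\<delta>>0. \<forall>E\<in>sets circle_measure.
        0 < measure circle_measure E \<and> measure circle_measure E < \<delta> \<longrightarrow>
        \<alpha> (indicator E) < \<epsilon>)"

definition norm_ext :: "((complex \<Rightarrow> complex) \<Rightarrow> real) \<Rightarrow> (complex \<Rightarrow> complex) \<Rightarrow> ennreal" where
  "norm_ext \<alpha> f =
     (SUP s \<in> {s. simple_function circle_measure s \<and>
                  (AE z in circle_measure. norm (s z) \<le> norm (f z))}. ennreal (\<alpha> s))"

definition Lcal_space :: "((complex \<Rightarrow> complex) \<Rightarrow> real) \<Rightarrow> (complex \<Rightarrow> complex) set" where
  "Lcal_space \<alpha> = {f \<in> borel_measurable circle_measure. norm_ext \<alpha> f < \<infinity>}"

definition L_space :: "((complex \<Rightarrow> complex) \<Rightarrow> real) \<Rightarrow> (complex \<Rightarrow> complex) set" where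
  "L_space \<alpha> = {f \<in> Lcal_space \<alpha>.
     \<forall>\<epsilon>>0. \<exists>g\<in>Linf_circle. norm_ext \<alpha> (\<lambda>z. f z - g z) < \<epsilon>}"

(* The linear span of 1, z, z^2, ... *)
definition analytic_polys :: "(complex \<Rightarrow> complex) set" where
  "analytic_polys = {p. \<exists>n c. p = (\<lambda>z. \<Sum>k\<le>(n::nat). c k * z ^ k)}"

definition H_space :: "((complex \<Rightarrow> complex) \<Rightarrow> real) \<Rightarrow> (complex \<Rightarrow> complex) set" where
  "H_space \<alpha> = {f \<in> L_space \<alpha>.
     \<forall>\<epsilon>>0. \<exists>p\<in>analytic_polys. norm_ext \<alpha> (\<lambda>z. f z - p z) < \<epsilon>}"

definition H1_space :: "(complex \<Rightarrow> complex) set" where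
  "H1_space = {f. integrable circle_measure f \<and>
     (\<forall>\<epsilon>>0. \<exists>p\<in>analytic_polys. (LINT z|circle_measure. norm (f z - p z)) < \<epsilon>)}"

(* The classical H^infinity: bounded functions whose Fourier coefficients of negative index
   vanish. The sup-norm closed span of the powers of z would only give the disc algebra. *)
definition Hinf_space :: "(complex \<Rightarrow> complex) set" where
  "Hinf_space = {f \<in> Linf_circle. \<forall>n\<ge>(1::nat). (LINT z|circle_measure. f z * z ^ n) = 0}"

definition inner_function :: "(complex \<Rightarrow> complex) \<Rightarrow> bool" where
  "inner_function \<phi> \<longleftrightarrow> \<phi> \<in> Hinf_space \<and> (AE z in circle_measure. norm (\<phi> z) = 1)"

(* The inclusion of the products h * g in H^1 holds automatically, so only density is required. *)
definition outer_function :: "(complex \<Rightarrow> complex) \<Rightarrow> bool" where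
  "outer_function g \<longleftrightarrow> g \<in> H1_space \<and>
     (\<forall>k\<in>H1_space. \<forall>\<epsilon>>0. \<exists>h\<in>Hinf_space.
        (LINT z|circle_measure. norm (k z - h z * g z)) < \<epsilon>)"

end

(* Since |phi| = 1 a.e., g = cnj phi * f lies in L^alpha together with f, so it is enough to show
   that L^alpha and H^1 intersect inside H^alpha.  The Fejer means of a function in H^1 are analytic
   polynomials.  They are alpha-contractions on trigonometric polynomials, being convex combinations
   of rotations there, and trigonometric polynomials are dense in the intersection of L^alpha and L^1
   for both norms simultaneously; hence the Fejer means of g converge to g in alpha. *)

theory Submission
  imports Defs "HOL-Library.Real_Mod"
begin

section \<open>The circle and its Fourier coefficients\<close>

text \<open>Convolution with the Fejer kernel is an integral of rotations, while \<alpha> offers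
  only the triangle inequality for finite sums. The integral is therefore replaced by an average
  over N-th roots of unity, which is exact on a trigonometric polynomial once N is large; hence
  contractivity is stated for such polynomials and not for \<open>g\<close>. The passage to
  \<open>g\<close> takes two approximants. A polynomial \<open>p\<close> determines the order n. A
  second one \<open>q\<close>, chosen after n, makes the n-th mean of \<open>g - q\<close> uniformly
  small through the crude bound by n times the L^1 norm, and contractivity handles
  \<open>p - q\<close>. So \<open>q\<close> must be close to \<open>g\<close> in \<alpha> and in L^1
  at once. A bounded function close to \<open>g\<close> in \<alpha> is not asserted to be close in
  L^1. A truncation of \<open>g\<close> takes its place, and the continuity of \<alpha> on small
  sets makes the truncation close in \<alpha> as well.\<close>

lemma space_circle [simp]: "space circle_measure = unit_circle"
  by (simp add: circle_measure_def space_restrict_space)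

lemma unit_circle_iff: "z \<in> unit_circle \<longleftrightarrow> norm z = 1"
  by (simp add: unit_circle_def)

lemma closed_unit_circle: "closed unit_circle" and compact_unit_circle: "compact unit_circle"
  by (simp_all add: unit_circle_def)

lemma sets_circle [measurable_cong]: "sets circle_measure = sets (restrict_space borel unit_circle)"
  by (simp add: circle_measure_def)

lemma unit_circle_borel: "unit_circle \<in> sets borel"
  using closed_unit_circle by auto

lemma cis_measurable_circle: "cis \<in> lborel \<rightarrow>\<^sub>M restrict_space borel unit_circle"
  by (intro measurable_restrict_space2)
    (auto simp: unit_circle_iff intro!: borel_measurable_continuous_onI continuous_intros)

lemma cis_measurable_uniform:
  "cis \<in> uniform_measure lborel {0..<2 * pi} \<rightarrow>\<^sub>M restrict_space borel unit_circle"
  using cis_measurable_circle by (simp add: measurable_def)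

lemma emeasure_circle_space: "emeasure circle_measure (space circle_measure) = 1"
proof -
  have "cis -` unit_circle = UNIV" by (auto simp: unit_circle_iff)
  then have "emeasure circle_measure (space circle_measure) =
      emeasure (uniform_measure lborel {0..<2 * pi}) UNIV"
    unfolding circle_measure_def
    by (subst emeasure_distr[OF cis_measurable_uniform])
      (auto simp: space_restrict_space sets_restrict_space unit_circle_borel)
  also have "\<dots> = 1"
    by (subst emeasure_uniform_measure) (auto simp: divide_ennreal)
  finally show ?thesis .
qed

interpretation circle: finite_measure circle_measure
  by standard (simp add: emeasure_circle_space del: space_circle)

lemma measure_unit_circle: "measure circle_measure unit_circle = 1"
  using emeasure_circle_space by (simp add: measure_def)

lemma continuous_measurable_circle:
  fixes f :: "complex \<Rightarrow> 'a::topological_space"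
  assumes "continuous_on unit_circle f"
  shows "f \<in> borel_measurable circle_measure"
  using borel_measurable_continuous_on_restrict[OF assms]
  by (simp add: measurable_cong_sets[OF sets_circle refl])

section \<open>The algebra of essentially bounded functions\<close>

lemma Linf_circleI:
  "f \<in> borel_measurable circle_measure \<Longrightarrow> AE z in circle_measure. norm (f z) \<le> C \<Longrightarrow> f \<in> Linf_circle"
  by (auto simp: Linf_circle_def)

lemma Linf_measurable: "f \<in> Linf_circle \<Longrightarrow> f \<in> borel_measurable circle_measure"
  by (simp add: Linf_circle_def)

lemma Linf_bounded:
  assumes "f \<in> Linf_circle"
  obtains C where "C > 0" "AE z in circle_measure. norm (f z) \<le> C"
proof -
  obtain C where "AE z in circle_measure. norm (f z) \<le> C"
    using assms by (auto simp: Linf_circle_def)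
  then have "AE z in circle_measure. norm (f z) \<le> max C 1" by eventually_elim auto
  then show ?thesis by (intro that[of "max C 1"]) auto
qed

lemma continuous_Linf:
  assumes "continuous_on unit_circle f"
  shows "f \<in> Linf_circle"
proof -
  have "bounded (f ` unit_circle)"
    using compact_continuous_image[OF assms compact_unit_circle] compact_imp_bounded by blast
  then obtain C where C: "\<And>z. z \<in> unit_circle \<Longrightarrow> norm (f z) \<le> C"
    by (auto simp: bounded_iff)
  have "AE z in circle_measure. norm (f z) \<le> C"
    by (intro AE_I2) (simp add: C)
  then show ?thesis
    by (rule Linf_circleI[OF continuous_measurable_circle[OF assms]])
qed

lemma Linf_add: "f \<in> Linf_circle \<Longrightarrow> g \<in> Linf_circle \<Longrightarrow> (\<lambda>z. f z + g z) \<in> Linf_circle"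
proof -
  assume f: "f \<in> Linf_circle" and g: "g \<in> Linf_circle"
  obtain C D where "AE z in circle_measure. norm (f z) \<le> C" "AE z in circle_measure. norm (g z) \<le> D"
    using Linf_bounded[OF f] Linf_bounded[OF g] by metis
  then have "AE z in circle_measure. norm (f z + g z) \<le> C + D"
    by eventually_elim (rule norm_triangle_mono)
  then show ?thesis
    using Linf_measurable[OF f] Linf_measurable[OF g] by (intro Linf_circleI) auto
qed

lemma Linf_mult: "f \<in> Linf_circle \<Longrightarrow> g \<in> Linf_circle \<Longrightarrow> (\<lambda>z. f z * g z) \<in> Linf_circle"
proof -
  assume f: "f \<in> Linf_circle" and g: "g \<in> Linf_circle"
  obtain C D where "C > 0" "AE z in circle_measure. norm (f z) \<le> C"
    "AE z in circle_measure. norm (g z) \<le> D"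
    using Linf_bounded[OF f] Linf_bounded[OF g] by metis
  then have "AE z in circle_measure. norm (f z * g z) \<le> C * D"
    by (auto simp: norm_mult elim!: eventually_elim2 intro!: mult_mono)
  then show ?thesis
    using Linf_measurable[OF f] Linf_measurable[OF g] by (intro Linf_circleI) auto
qed

lemma Linf_const: "(\<lambda>z. c) \<in> Linf_circle"
  by (rule Linf_circleI[of _ "norm c"]) auto

lemma Linf_cmult: "f \<in> Linf_circle \<Longrightarrow> (\<lambda>z. c * f z) \<in> Linf_circle"
  by (rule Linf_mult[OF Linf_const])

lemma Linf_diff: "f \<in> Linf_circle \<Longrightarrow> g \<in> Linf_circle \<Longrightarrow> (\<lambda>z. f z - g z) \<in> Linf_circle"
  using Linf_add[of f "\<lambda>z. (-1) * g z"] Linf_cmult[of g "-1"] by simp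

lemma Linf_sum: "(\<And>i. i \<in> I \<Longrightarrow> f i \<in> Linf_circle) \<Longrightarrow> (\<lambda>z. \<Sum>i\<in>I. f i z) \<in> Linf_circle"
  by (induction I rule: infinite_finite_induct) (auto intro: Linf_add Linf_const)

lemma Linf_norm: "f \<in> Linf_circle \<Longrightarrow> (\<lambda>z. of_real (norm (f z))) \<in> Linf_circle"
  by (auto simp: Linf_circle_def)

lemma Linf_cnj: "f \<in> Linf_circle \<Longrightarrow> (\<lambda>z. cnj (f z)) \<in> Linf_circle"
  by (auto simp: Linf_circle_def intro!: borel_measurable_continuous_on[where f = cnj] continuous_intros)

lemma Linf_integrable: "f \<in> Linf_circle \<Longrightarrow> integrable circle_measure f"
  by (auto simp: Linf_circle_def intro: circle.integrable_const_bound)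

section \<open>Integration over the circle and orthogonality of the powers of z\<close>

lemma integral_circle:
  fixes f :: "complex \<Rightarrow> complex"
  assumes "continuous_on unit_circle f"
  shows "(LINT z|circle_measure. f z) =
    (LINT t|lborel. indicator {0..2 * pi} t *\<^sub>R f (cis t)) / (2 * pi)"
proof -
  have f: "f \<in> borel_measurable (restrict_space borel unit_circle)"
    by (rule borel_measurable_continuous_on_restrict[OF assms])
  have fc: "(\<lambda>t. f (cis t)) \<in> borel_measurable lborel"
    using measurable_compose[OF cis_measurable_circle f] .
  have "(LINT z|circle_measure. f z) = (LINT t|uniform_measure lborel {0..<2*pi}. f (cis t))"
    unfolding circle_measure_def by (rule integral_distr[OF cis_measurable_uniform f])
  also have "\<dots> = (LINT t|density lborel (\<lambda>t. ennreal (indicator {0..<2*pi} t / (2*pi))). f (cis t))"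
    by (simp add: uniform_measure_def divide_ennreal flip: ennreal_indicator)
  also have "\<dots> = (LINT t|lborel. (indicator {0..<2*pi} t / (2*pi)) *\<^sub>R f (cis t))"
    using fc by (intro integral_density) auto
  \<comment> \<open>The half-open interval parametrises the circle once; adding the null endpoint
    \<open>2*pi\<close> yields the compact interval on which the fundamental theorem of calculus is
    applied.\<close>
  also have "\<dots> = (LINT t|lborel. (1 / (2 * pi)) *\<^sub>R (indicator {0..2*pi} t *\<^sub>R f (cis t)))"
    using fc
  proof (intro integral_cong_AE)
    show "AE t in lborel. (indicator {0..<2*pi} t / (2*pi)) *\<^sub>R f (cis t) =
      (1 / (2 * pi)) *\<^sub>R (indicator {0..2*pi} t *\<^sub>R f (cis t))"
      using AE_lborel_singleton[of "2*pi"] by eventually_elim (auto simp: indicator_def)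
  qed auto
  also have "\<dots> = (LINT t|lborel. indicator {0..2 * pi} t *\<^sub>R f (cis t)) / (2 * pi)"
    by (simp add: scaleR_conv_of_real)
  finally show ?thesis .
qed

lemma cis_powi: "cis t powi k = cis (of_int k * t)"
  by (cases "k \<ge> 0") (auto simp: power_int_def Complex.DeMoivre)

lemma continuous_powi: "continuous_on unit_circle (\<lambda>z::complex. z powi k)"
  by (intro continuous_intros) (auto simp: unit_circle_iff)

lemma Linf_powi: "(\<lambda>z. z powi k) \<in> Linf_circle"
  by (rule continuous_Linf[OF continuous_powi])

lemma norm_powi_circle: "norm z = 1 \<Longrightarrow> norm (z powi k :: complex) = 1"
  by (simp add: norm_power_int)

lemma powi_mult_circle: "norm z = 1 \<Longrightarrow> z powi a * z powi b = (z::complex) powi (a + b)"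
  by (subst power_int_add) auto

lemma cnj_circle: "norm w = 1 \<Longrightarrow> cnj w = w powi (- 1)"
proof -
  assume "norm w = 1"
  then have "w * cnj w = 1" by (simp add: complex_norm_square[symmetric])
  then show ?thesis by (simp add: power_int_minus inverse_unique)
qed

lemma integral_powi: "(LINT z|circle_measure. z powi k) = (if k = 0 then 1 else 0)"
proof (cases "k = 0")
  case True
  then show ?thesis by (simp add: measure_unit_circle)
next
  case False
  \<comment> \<open>A primitive of the integrand; its boundary values agree because k is an
    integer.\<close>
  define F where "F t = cis (of_int k * t) / (\<i> * of_int k)" for t :: real
  have "has_bochner_integral lborel (\<lambda>t. indicator {0..2*pi} t *\<^sub>R cis (of_int k * t))
      (F (2 * pi) - F 0)"
  proof (rule has_bochner_integral_FTC_Icc)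
    show "(F has_vector_derivative cis (of_int k * t)) (at t within {0..2 * pi})" for t
    proof -
      have "((\<lambda>t::complex. exp (\<i> * (of_int k * t)) / (\<i> * of_int k)) has_field_derivative 
        exp (\<i> * (of_int k * z))) (at z)" for z
        using False by (auto intro!: derivative_eq_intros) (simp add: mult_ac)
      from has_vector_derivative_real_field[OF this[of "of_real t"]] show ?thesis
        by (simp add: F_def[abs_def] cis_conv_exp o_def has_vector_derivative_at_within)
    qed
  qed (auto intro!: continuous_intros)
  then have "(LINT t|lborel. indicator {0..2*pi} t *\<^sub>R cis (of_int k * t)) = F (2 * pi) - F 0"
    by (rule has_bochner_integral_integral_eq)
  also have "\<dots> = 0"
    using cis_multiple_2pi[of "of_int k"] by (simp add: F_def mult.commute mult.left_commute)
  finally have "(LINT t|lborel. indicator {0..2*pi} t *\<^sub>R (cis t powi k)) = 0"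
    by (simp add: cis_powi)
  then show ?thesis
    using False by (subst integral_circle[OF continuous_powi]) simp
qed

section \<open>Fourier coefficients and their vanishing at negative frequencies on H^1\<close>

definition fcoeff :: "(complex \<Rightarrow> complex) \<Rightarrow> int \<Rightarrow> complex" where
  "fcoeff h k = (LINT z|circle_measure. h z * z powi (- k))"

lemma integrable_mult_Linf:
  assumes "integrable circle_measure h" "u \<in> Linf_circle"
  shows "integrable circle_measure (\<lambda>z. h z * u z)"
proof -
  obtain C where C: "C > 0" "AE z in circle_measure. norm (u z) \<le> C"
    using Linf_bounded[OF assms(2)] .
  have "integrable circle_measure (\<lambda>z. of_real C * h z)" using assms by simp
  then show ?thesis
  proof (rule Bochner_Integration.integrable_bound)
    show "AE z in circle_measure. norm (h z * u z) \<le> norm (of_real C * h z)"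
      using C(2) by eventually_elim (use C(1) in \<open>auto simp: norm_mult mult.commute[of C] intro: mult_left_mono\<close>)
  qed (use assms Linf_measurable in auto)
qed

lemma integrable_mult_powi:
  "integrable circle_measure h \<Longrightarrow> integrable circle_measure (\<lambda>z. h z * z powi k)"
  by (rule integrable_mult_Linf[OF _ Linf_powi])

lemma fcoeff_add:
  "integrable circle_measure h \<Longrightarrow> integrable circle_measure k \<Longrightarrow>
    fcoeff (\<lambda>z. h z + k z) m = fcoeff h m + fcoeff k m"
  by (simp add: fcoeff_def integrable_mult_powi distrib_right)

lemma fcoeff_cmult: "fcoeff (\<lambda>z. c * h z) m = c * fcoeff h m"
  by (simp add: fcoeff_def mult.assoc)

lemma fcoeff_diff:
  "integrable circle_measure h \<Longrightarrow> integrable circle_measure k \<Longrightarrow>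
    fcoeff (\<lambda>z. h z - k z) m = fcoeff h m - fcoeff k m"
  by (simp add: fcoeff_def integrable_mult_powi left_diff_distrib)

lemma fcoeff_powi: "fcoeff (\<lambda>z. z powi k) m = (if k = m then 1 else 0)"
proof -
  have "fcoeff (\<lambda>z. z powi k) m = (LINT z|circle_measure. z powi (k - m))"
    unfolding fcoeff_def
    by (intro Bochner_Integration.integral_cong refl)
      (simp add: unit_circle_iff powi_mult_circle)
  then show ?thesis by (simp add: integral_powi)
qed

text \<open>Powers of z are unimodular on the circle. The resulting L^1 continuity carries vanishing
  coefficients to limits and later bounds the Fejer means uniformly.\<close>

lemma norm_fcoeff_le:
  assumes "integrable circle_measure h"
  shows "norm (fcoeff h k) \<le> (LINT z|circle_measure. norm (h z))"
proof -
  have "norm (fcoeff h k) \<le> (LINT z|circle_measure. norm (h z * z powi (-k)))"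
    unfolding fcoeff_def by (rule integral_norm_bound)
  also have "\<dots> = (LINT z|circle_measure. norm (h z))"
    by (intro Bochner_Integration.integral_cong refl)
      (simp add: unit_circle_iff norm_mult norm_powi_circle)
  finally show ?thesis .
qed

lemma analytic_polys_continuous: "p \<in> analytic_polys \<Longrightarrow> continuous_on S p"
  by (auto simp: analytic_polys_def intro!: continuous_intros)

lemma fcoeff_analytic_poly:
  assumes "p \<in> analytic_polys" "k < 0"
  shows "fcoeff p k = 0"
proof -
  obtain n c where p: "p = (\<lambda>z. \<Sum>j\<le>(n::nat). c j * z ^ j)"
    using assms(1) by (auto simp: analytic_polys_def)
  have "fcoeff p k = (LINT z|circle_measure. (\<Sum>j\<le>n. c j * z powi (int j - k)))"
    unfolding fcoeff_def p
    by (intro Bochner_Integration.integral_cong refl)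
      (simp add: unit_circle_iff sum_distrib_right mult.assoc powi_mult_circle flip: power_int_of_nat)
  also have "\<dots> = (\<Sum>j\<le>n. c j * (LINT z|circle_measure. z powi (int j - k)))"
    by (subst Bochner_Integration.integral_sum) (auto intro!: Linf_integrable Linf_cmult Linf_powi)
  also have "\<dots> = 0" using assms(2) by (intro sum.neutral) (auto simp: integral_powi)
  finally show ?thesis .
qed

text \<open>Coefficients are L^1 continuous and vanish on analytic polynomials at negative
  frequencies. Together with integrability this is all that is used of H^1.\<close>

lemma fcoeff_H1:
  assumes "h \<in> H1_space" "k < 0"
  shows "fcoeff h k = 0"
proof (rule ccontr)
  assume nz: "fcoeff h k \<noteq> 0"
  have h: "integrable circle_measure h" using assms by (simp add: H1_space_def)
  obtain p where p: "p \<in> analytic_polys" "(LINT z|circle_measure. norm (h z - p z)) < norm (fcoeff h k)"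
    using assms nz zero_less_norm_iff[of "fcoeff h k"] unfolding H1_space_def by blast
  have pint: "integrable circle_measure p"
    by (intro Linf_integrable continuous_Linf analytic_polys_continuous p)
  have "norm (fcoeff h k) = norm (fcoeff (\<lambda>z. h z - p z) k)"
    by (simp add: fcoeff_diff h pint fcoeff_analytic_poly[OF p(1) assms(2)])
  also have "\<dots> \<le> (LINT z|circle_measure. norm (h z - p z))"
    using h pint by (intro norm_fcoeff_le) auto
  finally show False using p by simp
qed

section \<open>Monotonicity of the norm and its extension\<close>

text \<open>Rounding down to multiples of \<delta> leaves a bounded function with finitely many
  values. Rounding down, rather than to the nearest multiple, gives a minorant that stays
  nonnegative, so it is also a minorant in modulus.\<close>

lemma simple_function_floor_approx:
  fixes v :: "'a \<Rightarrow> real"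
  assumes [measurable]: "v \<in> borel_measurable M"
    and C: "\<And>z. z \<in> space M \<Longrightarrow> \<bar>v z\<bar> \<le> C" and "\<delta> > 0"
  obtains s where "simple_function M s"
    "\<And>z. s z \<le> v z" "\<And>z. v z \<le> s z + \<delta>" "\<And>z. 0 \<le> v z \<Longrightarrow> 0 \<le> s z"
proof
  let ?s = "\<lambda>z. \<delta> * of_int \<lfloor>v z / \<delta>\<rfloor>"
  show "simple_function M ?s"
  proof (rule simple_function_borel_measurable)
    have "?s ` space M \<subseteq> (\<lambda>i. \<delta> * of_int i) ` {\<lfloor>- C / \<delta>\<rfloor>..\<lfloor>C / \<delta>\<rfloor>}"
    proof (intro image_subsetI imageI)
      fix z assume "z \<in> space M"
      then have "- C \<le> v z" "v z \<le> C" using C[of z] by auto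
      then show "\<lfloor>v z / \<delta>\<rfloor> \<in> {\<lfloor>- C / \<delta>\<rfloor>..\<lfloor>C / \<delta>\<rfloor>}"
        using \<open>\<delta> > 0\<close> divide_right_mono[of "- C" "v z" \<delta>]
        by (auto intro!: floor_mono divide_right_mono)
    qed
    then show "finite (?s ` space M)"
      by (rule finite_subset) simp
  qed simp
  fix z
  show "?s z \<le> v z"
    using floor_divide_lower[OF \<open>\<delta> > 0\<close>, of "v z"] by (simp add: mult.commute)
  have "v z / \<delta> \<le> of_int \<lfloor>v z / \<delta>\<rfloor> + 1" by linarith
  then show "v z \<le> ?s z + \<delta>" using \<open>\<delta> > 0\<close> by (simp add: field_simps)
  show "0 \<le> ?s z" if "0 \<le> v z" using that \<open>\<delta> > 0\<close> by simp
qed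

lemma simple_function_Linf:
  assumes "simple_function circle_measure s"
  shows "s \<in> Linf_circle"
proof -
  have "finite (s ` unit_circle)" using simple_functionD(1)[OF assms] by simp
  then obtain C where "\<And>z. z \<in> unit_circle \<Longrightarrow> norm (s z) \<le> C"
    using finite_imp_bounded[of "s ` unit_circle"] by (auto simp: bounded_iff)
  then have "AE z in circle_measure. norm (s z) \<le> C" by (intro AE_I2) simp
  then show ?thesis
    by (rule Linf_circleI[OF borel_measurable_simple_function[OF assms]])
qed

lemma Linf_indicator: "A \<in> sets circle_measure \<Longrightarrow> indicator A \<in> Linf_circle"
  by (rule Linf_circleI[of _ 1]) (auto simp: indicator_def)

lemma norm_ext_mono:
  assumes "AE z in circle_measure. norm (F z) \<le> norm (G z)"
  shows "norm_ext \<alpha> F \<le> norm_ext \<alpha> G"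
proof -
  have "AE z in circle_measure. norm (s z) \<le> norm (G z)"
    if "AE z in circle_measure. norm (s z) \<le> norm (F z)" for s :: "complex \<Rightarrow> complex"
    using that assms by eventually_elim (rule order_trans)
  then show ?thesis unfolding norm_ext_def by (intro SUP_subset_mono Collect_mono) (blast, simp)
qed

lemma norm_ext_cong:
  assumes "AE z in circle_measure. norm (F z) = norm (G z)"
  shows "norm_ext \<alpha> F = norm_ext \<alpha> G"
proof (rule antisym)
  show "norm_ext \<alpha> F \<le> norm_ext \<alpha> G"
    by (rule norm_ext_mono, use assms in eventually_elim) simp
  show "norm_ext \<alpha> G \<le> norm_ext \<alpha> F"
    by (rule norm_ext_mono, use assms in eventually_elim) simp
qed

section \<open>Consequences of the norm axioms and the triangle inequality for the extended
  norm\<close>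

locale rot_sym_norm =
  fixes \<alpha> :: "(complex \<Rightarrow> complex) \<Rightarrow> real"
  assumes rot_sym: "cont_rot_sym_norm \<alpha>"
begin

lemma nonneg: "f \<in> Linf_circle \<Longrightarrow> 0 \<le> \<alpha> f"
  and zero_iff: "f \<in> Linf_circle \<Longrightarrow> \<alpha> f = 0 \<longleftrightarrow> (AE z in circle_measure. f z = 0)"
  and scale: "f \<in> Linf_circle \<Longrightarrow> \<alpha> (\<lambda>z. c * f z) = norm c * \<alpha> f"
  and triangle: "f \<in> Linf_circle \<Longrightarrow> g \<in> Linf_circle \<Longrightarrow> \<alpha> (\<lambda>z. f z + g z) \<le> \<alpha> f + \<alpha> g"
  and one: "\<alpha> (\<lambda>z. 1) = 1"
  and norm_eq: "f \<in> Linf_circle \<Longrightarrow> \<alpha> (\<lambda>z. of_real (norm (f z))) = \<alpha> f"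
  and rotate: "w \<in> unit_circle \<Longrightarrow> f \<in> Linf_circle \<Longrightarrow> \<alpha> (\<lambda>z. f (cnj w * z)) = \<alpha> f"
  using rot_sym unfolding cont_rot_sym_norm_def by blast+

text \<open>\<alpha> acts on functions rather than on a.e.-classes, so invariance under null sets
  has to be derived: the difference vanishes a.e. and has norm zero by definiteness.\<close>

lemma cong:
  assumes f: "f \<in> Linf_circle" and g: "g \<in> Linf_circle" and "AE z in circle_measure. f z = g z"
  shows "\<alpha> f = \<alpha> g"
proof -
  have le: "\<alpha> h \<le> \<alpha> k"
    if h: "h \<in> Linf_circle" and k: "k \<in> Linf_circle" and ae: "AE z in circle_measure. h z = k z" for h k
  proof -
    have "\<alpha> h = \<alpha> (\<lambda>z. k z + (h z - k z))" by simp
    also have "\<dots> \<le> \<alpha> k + \<alpha> (\<lambda>z. h z - k z)" by (intro triangle Linf_diff h k)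
    also have "\<alpha> (\<lambda>z. h z - k z) = 0"
      by (subst zero_iff[OF Linf_diff[OF h k]]) (use ae in \<open>eventually_elim, simp\<close>)
    finally show ?thesis by simp
  qed
  show ?thesis
    using le[OF f g assms(3)] le[OF g f] assms(3) by (auto simp: eq_commute)
qed

text \<open>A number t in [0,1] is the mean of the unimodular number t + i sqrt(1 - t^2) and its
  conjugate. Writing |f| = t |g| makes |f| the mean of two functions of modulus |g|, and both have
  the norm of g because \<alpha> sees only the modulus.\<close>

lemma mono:
  assumes f: "f \<in> Linf_circle" and g: "g \<in> Linf_circle"
    and le: "AE z in circle_measure. norm (f z) \<le> norm (g z)"
  shows "\<alpha> f \<le> \<alpha> g"
proof -
  \<comment> \<open>The cap at 1 keeps \<open>u\<close> unimodular even on the null set where the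
    bound fails. At zeros of \<open>g\<close> the quotient is 0 by convention, which agrees with
    \<open>f\<close> vanishing there a.e.\<close>
  define t where "t z = min 1 (norm (f z) / norm (g z))" for z
  define u where "u z = Complex (t z) (sqrt (1 - (t z)\<^sup>2))" for z
  have [measurable]: "f \<in> borel_measurable circle_measure" "g \<in> borel_measurable circle_measure"
    using f g by (auto dest: Linf_measurable)
  have t: "0 \<le> t z" "t z \<le> 1" for z by (auto simp: t_def)
  then have nu: "norm (u z) = 1" for z
    by (simp add: u_def cmod_def power_le_one)
  have [measurable]: "u \<in> borel_measurable circle_measure"
    unfolding u_def t_def Complex_eq by measurable
  have u: "u \<in> Linf_circle" by (rule Linf_circleI[of _ 1]) (auto simp: nu)
  have cu: "(\<lambda>z. cnj (u z)) \<in> Linf_circle" by (rule Linf_cnj[OF u])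
  let ?g = "\<lambda>z. complex_of_real (norm (g z))"
  have gl: "?g \<in> Linf_circle" by (rule Linf_norm[OF g])
  have eq: "\<alpha> (\<lambda>z. ?g z * v z) = \<alpha> g" if v: "v \<in> Linf_circle" "\<And>z. norm (v z) = 1" for v
    using norm_eq[OF Linf_mult[OF gl v(1)]] norm_eq[OF g] by (simp add: norm_mult v(2))
  have l: "(\<lambda>z. ?g z * u z + ?g z * cnj (u z)) \<in> Linf_circle"
    by (intro Linf_add Linf_mult gl u cu)
  have "\<alpha> f = \<alpha> (\<lambda>z. of_real (norm (f z)))" by (simp add: norm_eq f)
  also have "\<dots> = \<alpha> (\<lambda>z. (1/2) * (?g z * u z + ?g z * cnj (u z)))"
  proof (rule cong[OF Linf_norm[OF f] Linf_cmult[OF l]])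
    show "AE z in circle_measure. of_real (norm (f z)) = (1/2) * (?g z * u z + ?g z * cnj (u z))"
      using le
    proof eventually_elim
      case (elim z)
      then have "norm (f z) = norm (g z) * t z"
        by (cases "g z = 0") (auto simp: t_def min_def field_simps)
      then show ?case by (simp add: complex_eq_iff u_def)
    qed
  qed
  also have "\<dots> = 1/2 * \<alpha> (\<lambda>z. ?g z * u z + ?g z * cnj (u z))"
    using scale[OF l, of "1/2"] by simp
  also have "\<dots> \<le> 1/2 * (\<alpha> (\<lambda>z. ?g z * u z) + \<alpha> (\<lambda>z. ?g z * cnj (u z)))"
    by (intro mult_left_mono triangle Linf_mult gl u cu) simp
  also have "\<dots> = \<alpha> g" using eq[OF u] eq[OF cu] nu by simp
  finally show ?thesis .
qed

lemma le_bound: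
  assumes "f \<in> Linf_circle" "AE z in circle_measure. norm (f z) \<le> C" "0 \<le> C"
  shows "\<alpha> f \<le> C"
proof -
  have "\<alpha> f \<le> \<alpha> (\<lambda>z. of_real C * 1)"
    using assms by (intro mono Linf_const) auto
  also have "\<dots> = C" using assms(3) by (subst scale[OF Linf_const]) (simp add: one)
  finally show ?thesis .
qed

lemma sum_le:
  assumes "finite I" "\<And>i. i \<in> I \<Longrightarrow> f i \<in> Linf_circle"
  shows "\<alpha> (\<lambda>z. \<Sum>i\<in>I. f i z) \<le> (\<Sum>i\<in>I. \<alpha> (f i))"
  using assms
proof (induction I)
  case empty
  show ?case using zero_iff[OF Linf_const[of 0]] by simp
next
  case (insert i I)
  have "\<alpha> (\<lambda>z. f i z + (\<Sum>i\<in>I. f i z)) \<le> \<alpha> (f i) + \<alpha> (\<lambda>z. \<Sum>i\<in>I. f i z)"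
    using insert.prems by (intro triangle Linf_sum) auto
  with insert show ?case by (simp add: add.commute)
qed

text \<open>The continuity axiom speaks of sets of positive measure; the indicator of a null set has
  norm zero by definiteness, so both cases obey one bound.\<close>

lemma indicator_small:
  assumes "\<epsilon> > 0"
  obtains \<delta> where "\<delta> > 0"
    "\<And>E. E \<in> sets circle_measure \<Longrightarrow> measure circle_measure E < \<delta> \<Longrightarrow> \<alpha> (indicator E) < \<epsilon>"
proof -
  obtain \<delta> where \<delta>: "\<delta> > 0" "\<And>E. E \<in> sets circle_measure \<Longrightarrow> 0 < measure circle_measure E \<Longrightarrow>
      measure circle_measure E < \<delta> \<Longrightarrow> \<alpha> (indicator E) < \<epsilon>"
    using rot_sym assms unfolding cont_rot_sym_norm_def by blast
  have "\<alpha> (indicator E) < \<epsilon>" if E: "E \<in> sets circle_measure" "measure circle_measure E < \<delta>" for E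
  proof (cases "measure circle_measure E = 0")
    case True
    then have "E \<in> null_sets circle_measure"
      using E by (auto simp: null_sets_def circle.emeasure_eq_measure)
    then have "AE z in circle_measure. indicator E z = (0::complex)"
      by (rule AE_not_in[THEN eventually_mono]) simp
    then show ?thesis using zero_iff[OF Linf_indicator[OF E(1)]] assms by simp
  next
    case False
    then show ?thesis using \<delta>(2)[OF E(1)] E(2) by (simp add: less_le)
  qed
  with \<delta>(1) show ?thesis by (rule that)
qed

text \<open>The supremum in \<open>norm_ext\<close> ranges over simple functions, whereas
  truncations such as min(|s|, |F|) are merely bounded. Rounding |u| down gives a simple minorant
  with uniform error at most e, which costs at most e in \<alpha>.\<close>

lemma norm_ext_ge:
  assumes u: "u \<in> Linf_circle" and le: "AE z in circle_measure. norm (u z) \<le> norm (F z)"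
  shows "ennreal (\<alpha> u) \<le> norm_ext \<alpha> F"
proof (rule ennreal_le_epsilon)
  fix e :: real assume "0 < e"
  have [measurable]: "u \<in> borel_measurable circle_measure" using u by (rule Linf_measurable)
  obtain C where C: "C > 0" "AE z in circle_measure. norm (u z) \<le> C" using Linf_bounded[OF u] .
  \<comment> \<open>\<open>C\<close> bounds \<open>u\<close> only a.e.; the cap provides the bound
    at every point that the rounding requires.\<close>
  define v where "v z = min (norm (u z)) C" for z
  obtain s where s: "simple_function circle_measure s"
    "\<And>z. s z \<le> v z" "\<And>z. v z \<le> s z + e" "\<And>z. 0 \<le> v z \<Longrightarrow> 0 \<le> s z"
  proof (rule simple_function_floor_approx[of v circle_measure C e])
    show "v \<in> borel_measurable circle_measure" unfolding v_def by measurable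
  qed (use C \<open>0 < e\<close> in \<open>auto simp: v_def\<close>)
  have s0: "0 \<le> s z" for z using s(4)[of z] C(1) by (simp add: v_def)
  let ?s = "\<lambda>z. complex_of_real (s z)"
  have ss: "simple_function circle_measure ?s" by (rule simple_function_compose1[OF s(1)])
  have sl: "?s \<in> Linf_circle" by (rule simple_function_Linf[OF ss])
  have ul: "(\<lambda>z. complex_of_real (norm (u z))) \<in> Linf_circle" by (rule Linf_norm[OF u])
  have "\<alpha> u = \<alpha> (\<lambda>z. ?s z + (of_real (norm (u z)) - ?s z))" by (simp add: norm_eq[OF u])
  also have "\<dots> \<le> \<alpha> ?s + \<alpha> (\<lambda>z. of_real (norm (u z)) - ?s z)"
    by (intro triangle Linf_diff sl ul)
  also have "\<alpha> (\<lambda>z. of_real (norm (u z)) - ?s z) \<le> e"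
  proof (rule le_bound[OF Linf_diff[OF ul sl]])
    show "AE z in circle_measure. norm (complex_of_real (norm (u z)) - ?s z) \<le> e"
      using C(2)
    proof eventually_elim
      case (elim z)
      then show ?case using s(2,3)[of z] by (simp add: v_def norm_of_real flip: of_real_diff)
    qed
  qed (use \<open>0 < e\<close> in simp)
  finally have "ennreal (\<alpha> u) \<le> ennreal (\<alpha> ?s) + ennreal e"
    using \<open>0 < e\<close> nonneg[OF sl] by (simp add: ennreal_leI flip: ennreal_plus)
  also have "ennreal (\<alpha> ?s) \<le> norm_ext \<alpha> F"
    unfolding norm_ext_def
  proof (rule SUP_upper, safe)
    show "AE z in circle_measure. norm (?s z) \<le> norm (F z)"
      using le
    proof eventually_elim
      case (elim z)
      then show ?case using s(2)[of z] s0[of z] by (simp add: v_def)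
    qed
  qed (rule ss)
  finally show "ennreal (\<alpha> u) \<le> norm_ext \<alpha> F + ennreal e" by (simp add: add_right_mono)
qed

lemma norm_ext_Linf:
  assumes u: "u \<in> Linf_circle"
  shows "norm_ext \<alpha> u = ennreal (\<alpha> u)"
proof (rule antisym)
  show "norm_ext \<alpha> u \<le> ennreal (\<alpha> u)"
    unfolding norm_ext_def
    by (intro SUP_least ennreal_leI mono u) (auto intro: simple_function_Linf)
qed (rule norm_ext_ge[OF u], simp)

text \<open>Riesz decomposition: |s| splits into its part below |F| and a remainder, which lies
  below |G| a.e. because |s| \<le> |F| + |G| there. Both parts are bounded by |s|, so the triangle
  inequality for \<alpha> applies to them.\<close>

lemma norm_ext_add:
  assumes [measurable]: "F \<in> borel_measurable circle_measure" "G \<in> borel_measurable circle_measure"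
  shows "norm_ext \<alpha> (\<lambda>z. F z + G z) \<le> norm_ext \<alpha> F + norm_ext \<alpha> G"
  unfolding norm_ext_def[of _ "\<lambda>z. F z + G z"]
proof (rule SUP_least, safe)
  fix s :: "complex \<Rightarrow> complex"
  assume ss: "simple_function circle_measure s"
    and le: "AE z in circle_measure. norm (s z) \<le> norm (F z + G z)"
  have s: "s \<in> Linf_circle" by (rule simple_function_Linf[OF ss])
  have [measurable]: "s \<in> borel_measurable circle_measure" by (rule Linf_measurable[OF s])
  let ?u = "\<lambda>z. complex_of_real (min (norm (s z)) (norm (F z)))"
  let ?v = "\<lambda>z. complex_of_real (norm (s z) - min (norm (s z)) (norm (F z)))"
  obtain C where C: "AE z in circle_measure. norm (s z) \<le> C" using Linf_bounded[OF s] by blast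
  have u: "?u \<in> Linf_circle"
    by (rule Linf_circleI[of _ C], measurable, use C in eventually_elim) auto
  have v: "?v \<in> Linf_circle"
  proof (rule Linf_circleI[of _ C])
    show "AE z in circle_measure. norm (?v z) \<le> C"
      using C
    proof eventually_elim
      case (elim z)
      then show ?case using norm_ge_zero[of "F z"] norm_ge_zero[of "s z"]
        by (simp add: min_def norm_of_real del: of_real_diff norm_ge_zero)
    qed
  qed measurable
  have "\<alpha> s = \<alpha> (\<lambda>z. ?u z + ?v z)" by (simp add: norm_eq[OF s])
  also have "\<dots> \<le> \<alpha> ?u + \<alpha> ?v" by (rule triangle[OF u v])
  finally have "ennreal (\<alpha> s) \<le> ennreal (\<alpha> ?u) + ennreal (\<alpha> ?v)"
    using nonneg[OF u] nonneg[OF v] by (simp add: ennreal_leI flip: ennreal_plus)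
  also have "ennreal (\<alpha> ?u) \<le> norm_ext \<alpha> F"
    by (rule norm_ext_ge[OF u]) auto
  also have "ennreal (\<alpha> ?v) \<le> norm_ext \<alpha> G"
  proof (rule norm_ext_ge[OF v])
    show "AE z in circle_measure. norm (?v z) \<le> norm (G z)"
      using le
    proof eventually_elim
      case (elim z)
      then show ?case
        using norm_triangle_ineq[of "F z" "G z"] by (auto simp: min_def simp del: of_real_diff)
    qed
  qed
  finally show "ennreal (\<alpha> s) \<le> norm_ext \<alpha> F + norm_ext \<alpha> G" by (simp add: add_mono)
qed

end

section \<open>Density of trigonometric polynomials\<close>

text \<open>Generation from monomials by addition supplies the induction used later: a statement
  linear in the polynomial is checked on a single power.\<close>

inductive_set trig_polys :: "(complex \<Rightarrow> complex) set" where
  monom: "(\<lambda>z. c * z powi k) \<in> trig_polys"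
| add: "p \<in> trig_polys \<Longrightarrow> q \<in> trig_polys \<Longrightarrow> (\<lambda>z. p z + q z) \<in> trig_polys"

lemma trig_polys_Linf: "p \<in> trig_polys \<Longrightarrow> p \<in> Linf_circle"
  by (induction rule: trig_polys.induct) (intro Linf_cmult Linf_powi Linf_add; assumption)+

lemma trig_polys_cmult: "p \<in> trig_polys \<Longrightarrow> (\<lambda>z. c * p z) \<in> trig_polys"
proof (induction rule: trig_polys.induct)
  case (monom d k)
  then show ?case using trig_polys.monom[of "c * d" k] by (simp add: mult.assoc)
next
  case (add p q)
  then show ?case using trig_polys.add by (simp add: distrib_left)
qed

lemma trig_polys_diff:
  assumes "p \<in> trig_polys" "q \<in> trig_polys"
  shows "(\<lambda>z. p z - q z) \<in> trig_polys"
  using trig_polys.add[OF assms(1) trig_polys_cmult[OF assms(2), of "-1"]] by simp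

text \<open>The product is matched on the circle only: exponents do not add at 0, where
  \<open>0 powi 1 * 0 powi (-1)\<close> is 0 and not 1.\<close>

lemma trig_polys_mult:
  assumes "p \<in> trig_polys" "q \<in> trig_polys"
  shows "\<exists>r\<in>trig_polys. \<forall>z\<in>unit_circle. r z = p z * q z"
  using assms
proof (induction rule: trig_polys.induct)
  case (monom c k)
  show ?case using monom.prems
  proof (induction rule: trig_polys.induct)
    case (monom d l)
    show ?case
      by (rule bexI[OF _ trig_polys.monom[of "c * d" "k + l"]])
        (simp add: unit_circle_iff mult_ac flip: powi_mult_circle)
  next
    case (add p q)
    then obtain r s where "r \<in> trig_polys" "s \<in> trig_polys"
      "\<forall>z\<in>unit_circle. r z = (c * z powi k) * p z" "\<forall>z\<in>unit_circle. s z = (c * z powi k) * q z"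
      by blast
    then show ?case
      by (intro bexI[OF _ trig_polys.add[of r s]]) (auto simp: distrib_left)
  qed
next
  case (add p p')
  then obtain r s where "r \<in> trig_polys" "s \<in> trig_polys"
    "\<forall>z\<in>unit_circle. r z = p z * q z" "\<forall>z\<in>unit_circle. s z = p' z * q z"
    by blast
  then show ?case
    by (intro bexI[OF _ trig_polys.add[of r s]]) (auto simp: distrib_right)
qed

lemma real_polynomial_trig_poly:
  fixes f :: "complex \<Rightarrow> real"
  assumes "real_polynomial_function f"
  shows "\<exists>p\<in>trig_polys. \<forall>z\<in>unit_circle. p z = of_real (f z)"
  using assms
proof (induction rule: real_polynomial_function.induct)
  case (linear f)
  interpret f: bounded_linear f by fact
  \<comment> \<open>With this \<open>a\<close>, the number \<open>2 * Re (a * z)\<close> is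
    \<open>Re z * f 1 + Im z * f \<i>\<close>, and on the circle the conjugate of \<open>z\<close>
    is \<open>z powi (-1)\<close>.\<close>
  define a where "a = Complex (f 1) (- f \<i>) / 2"
  have eq: "of_real (f z) = a * z powi 1 + cnj a * z powi (-1)" if "z \<in> unit_circle" for z
  proof -
    have "z = Re z *\<^sub>R 1 + Im z *\<^sub>R \<i>" by (simp add: complex_eq_iff)
    then have fz: "f z = Re z * f 1 + Im z * f \<i>"
      using f.add f.scaleR by (metis real_scaleR_def)
    have zi: "z powi (-1) = cnj z"
      using that by (simp add: unit_circle_iff cnj_circle del: power_int_minus_left)
    show ?thesis unfolding fz zi by (simp add: complex_eq_iff a_def field_simps)
  qed
  then show ?case
    by (intro bexI[OF _ trig_polys.add[OF trig_polys.monom[of a 1] trig_polys.monom[of "cnj a" "-1"]]]) simp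
next
  case (const c)
  show ?case by (rule bexI[OF _ trig_polys.monom[of "of_real c" 0]]) simp
next
  case (add f g)
  then obtain p q where "p \<in> trig_polys" "q \<in> trig_polys"
    "\<forall>z\<in>unit_circle. p z = of_real (f z)" "\<forall>z\<in>unit_circle. q z = of_real (g z)" by blast
  then show ?case by (intro bexI[OF _ trig_polys.add[of p q]]) auto
next
  case (mult f g)
  then obtain p q where pq: "p \<in> trig_polys" "q \<in> trig_polys"
    "\<forall>z\<in>unit_circle. p z = of_real (f z)" "\<forall>z\<in>unit_circle. q z = of_real (g z)" by blast
  obtain r where "r \<in> trig_polys" "\<forall>z\<in>unit_circle. r z = p z * q z"
    using trig_polys_mult[OF pq(1,2)] by blast
  then show ?case using pq by (intro bexI[of _ r]) auto
qed

lemma trig_polys_uniformly_dense: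
  assumes "continuous_on unit_circle f" "e > 0"
  shows "\<exists>p\<in>trig_polys. \<forall>z\<in>unit_circle. norm (f z - p z) < e"
proof -
  obtain g where g: "polynomial_function g" "\<forall>z\<in>unit_circle. norm (f z - g z) < e"
    using Stone_Weierstrass_polynomial_function[OF compact_unit_circle assms] by blast
  have "real_polynomial_function (Re \<circ> g)" "real_polynomial_function (Im \<circ> g)"
    using g(1) bounded_linear_Re bounded_linear_Im by (auto simp: polynomial_function_def)
  then obtain p q where pq: "p \<in> trig_polys" "q \<in> trig_polys"
    "\<forall>z\<in>unit_circle. p z = of_real (Re (g z))" "\<forall>z\<in>unit_circle. q z = of_real (Im (g z))"
    using real_polynomial_trig_poly[of "Re \<circ> g"] real_polynomial_trig_poly[of "Im \<circ> g"]
    by (auto simp: o_def)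
  show ?thesis
  proof (rule bexI[OF _ trig_polys.add[OF pq(1) trig_polys_cmult[OF pq(2), of \<i>]]])
    show "\<forall>z\<in>unit_circle. norm (f z - (p z + \<i> * q z)) < e"
      using g(2) pq(3,4) by (simp flip: complex_eq)
  qed
qed

section \<open>Approximating indicators by continuous functions off a set of small measure\<close>

lemma of_real_indicator: "complex_of_real (indicator A z) = indicator A z"
  by (simp add: indicator_def)

text \<open>Outer regularity encloses A and its complement in open sets U and V whose overlap has
  small measure. A Urysohn function that is 0 off U and 1 off V agrees with the indicator of A
  outside the overlap.\<close>

lemma circle_measurable_squeeze:
  assumes A: "A \<in> sets circle_measure" and "\<delta> > 0"
  obtains E and f :: "complex \<Rightarrow> real" where "E \<in> sets circle_measure" "measure circle_measure E < \<delta>"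
    "continuous_on UNIV f" "\<And>z. z \<in> unit_circle \<Longrightarrow> \<bar>indicator A z - f z\<bar> \<le> indicator E z"
proof -
  \<comment> \<open>\<open>outer_regular\<close> concerns measures on the Borel sets of a whole
    space, so the measure is pushed forward into the plane.\<close>
  define M where "M = distr circle_measure borel (\<lambda>z. z)"
  have id: "(\<lambda>z. z) \<in> circle_measure \<rightarrow>\<^sub>M borel"
    by (rule continuous_measurable_circle) (rule continuous_on_id)
  have sM: "sets M = sets borel" by (simp add: M_def)
  interpret M: finite_measure M
    unfolding M_def by (rule circle.finite_measure_distr[OF id])
  have fin: "emeasure M (space M) \<noteq> \<infinity>" by simp
  have Ab: "A \<in> sets borel"
    using A unit_circle_borel
    by (auto simp: sets_circle sets_restrict_space_iff)
  have spM: "space M = UNIV" by (simp add: M_def)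
  have cover: "\<exists>U. B \<subseteq> U \<and> open U \<and> measure M U < measure M B + \<delta> / 2" if B: "B \<in> sets borel" for B
  proof -
    have "emeasure M B < emeasure M B + ennreal (\<delta> / 2)"
      using \<open>\<delta> > 0\<close> by (simp add: M.emeasure_eq_measure ennreal_less_iff flip: ennreal_plus)
    then have "(INF U \<in> {U. B \<subseteq> U \<and> open U}. emeasure M U) < emeasure M B + ennreal (\<delta> / 2)"
      using outer_regular[OF sM fin B] by simp
    then obtain U where "B \<subseteq> U" "open U" "emeasure M U < emeasure M B + ennreal (\<delta> / 2)"
      by (auto simp: INF_less_iff)
    then show ?thesis
      using \<open>\<delta> > 0\<close>
      by (auto simp: M.emeasure_eq_measure ennreal_less_iff simp flip: ennreal_plus)
  qed
  obtain U where U: "A \<subseteq> U" "open U" "measure M U < measure M A + \<delta> / 2" using cover[OF Ab] by blast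
  obtain V where V: "- A \<subseteq> V" "open V" "measure M V < measure M (- A) + \<delta> / 2"
    using cover[of "- A"] Ab by (auto simp: borel_comp)
  have [measurable]: "U \<in> sets M" "V \<in> sets M" "A \<in> sets M" using U V Ab by (auto simp: sM)
  \<comment> \<open>U and V cover the plane, so the excess of their measures over the total mass is
    exactly the measure of the overlap.\<close>
  have "measure M U + measure M V = measure M (U \<union> V) + measure M (U \<inter> V)"
    using measure_Un3[of U M V] by (simp add: fmeasurable_def M.emeasure_eq_measure)
  moreover have "U \<union> V = UNIV" using U V by auto
  moreover have "measure M A + measure M (- A) = measure M UNIV"
    using M.finite_measure_compl[of A] by (simp add: spM Compl_eq_Diff_UNIV)
  ultimately have small: "measure M (U \<inter> V) < \<delta>" using U(3) V(3) by simp
  obtain f :: "complex \<Rightarrow> real" where f: "continuous_on UNIV f"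
    "\<And>z. f z \<in> closed_segment 0 1" "\<And>z. f z = 0 \<longleftrightarrow> z \<in> - U" "\<And>z. f z = 1 \<longleftrightarrow> z \<in> - V"
  proof (rule Urysohn_strong[of "- U" "- V" "0::real" 1])
    show "closed (- U)" "closed (- V)" "- U \<inter> - V = {}" using U V by auto
  qed auto
  show ?thesis
  proof
    have pre: "(\<lambda>z. z) -` (U \<inter> V) \<inter> space circle_measure = U \<inter> V \<inter> unit_circle" by auto
    show "U \<inter> V \<inter> unit_circle \<in> sets circle_measure"
      using U V by (auto simp: sets_circle sets_restrict_space_iff unit_circle_borel)
    show "measure circle_measure (U \<inter> V \<inter> unit_circle) < \<delta>"
      using small unfolding M_def
      by (subst (asm) measure_distr[OF id]) (use U V in \<open>auto simp: pre\<close>)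
    show "continuous_on UNIV f" by fact
    show "\<bar>indicator A z - f z\<bar> \<le> indicator (U \<inter> V \<inter> unit_circle) z" if "z \<in> unit_circle" for z
    proof -
      have "0 \<le> f z" "f z \<le> 1" using f(2)[of z] by (auto simp: closed_segment_eq_real_ivl)
      then show ?thesis
        using that U(1) V(1) f(3)[of z] f(4)[of z] by (auto simp: indicator_def)
    qed
  qed
qed

section \<open>Density of trigonometric polynomials in the bounded functions\<close>

context rot_sym_norm
begin

text \<open>Adding the two norms turns simultaneous approximation into approximation in a single
  norm that is still monotone in the modulus.\<close>

definition sum_norm :: "(complex \<Rightarrow> complex) \<Rightarrow> real" where
  "sum_norm b = \<alpha> b + (LINT z|circle_measure. norm (b z))"

lemma sum_norm_triangle:
  assumes "b \<in> Linf_circle" "c \<in> Linf_circle"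
  shows "sum_norm (\<lambda>z. b z + c z) \<le> sum_norm b + sum_norm c"
proof -
  have "(LINT z|circle_measure. norm (b z + c z)) \<le> (LINT z|circle_measure. norm (b z) + norm (c z))"
    by (intro integral_mono Bochner_Integration.integrable_add integrable_norm Linf_integrable
      Linf_add assms norm_triangle_ineq)
  also have "\<dots> = (LINT z|circle_measure. norm (b z)) + (LINT z|circle_measure. norm (c z))"
    by (intro Bochner_Integration.integral_add integrable_norm Linf_integrable assms)
  finally show ?thesis using triangle[OF assms] by (simp add: sum_norm_def)
qed

lemma sum_norm_scale: "b \<in> Linf_circle \<Longrightarrow> sum_norm (\<lambda>z. c * b z) = norm c * sum_norm b"
  by (simp add: sum_norm_def scale norm_mult distrib_left)

lemma sum_norm_mono:
  assumes "b \<in> Linf_circle" "c \<in> Linf_circle" "AE z in circle_measure. norm (b z) \<le> norm (c z)"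
  shows "sum_norm b \<le> sum_norm c"
  unfolding sum_norm_def
  by (intro add_mono mono integral_mono_AE integrable_norm Linf_integrable assms)

lemma sum_norm_nonneg: "b \<in> Linf_circle \<Longrightarrow> 0 \<le> sum_norm b"
  by (simp add: sum_norm_def nonneg)

text \<open>The factor 2 arises because a constant contributes its modulus once through \<alpha> and
  once through the L^1 norm.\<close>

lemma sum_norm_bound:
  assumes "b \<in> Linf_circle" "AE z in circle_measure. norm (b z) \<le> C" "0 \<le> C"
  shows "sum_norm b \<le> 2 * C"
proof -
  have "sum_norm b \<le> sum_norm (\<lambda>z. of_real C * 1)"
    using assms by (intro sum_norm_mono Linf_const) auto
  also have "\<dots> = 2 * C"
    using assms(3) by (subst sum_norm_scale[OF Linf_const])
      (simp add: one sum_norm_def measure_unit_circle)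
  finally show ?thesis .
qed

text \<open>This class is closed under limits in \<open>sum_norm\<close> and under linear
  combinations, so it can be enlarged from continuous functions to indicators, simple functions and
  finally bounded ones.\<close>

definition approximable :: "(complex \<Rightarrow> complex) \<Rightarrow> bool" where
  "approximable b \<longleftrightarrow> (\<forall>\<epsilon>>0. \<exists>p\<in>trig_polys. sum_norm (\<lambda>z. b z - p z) < \<epsilon>)"

lemma approximable_limit:
  assumes b: "b \<in> Linf_circle"
    and lim: "\<And>\<epsilon>. \<epsilon> > 0 \<Longrightarrow> \<exists>c\<in>Linf_circle. approximable c \<and> sum_norm (\<lambda>z. b z - c z) < \<epsilon>"
  shows "approximable b"
  unfolding approximable_def
proof (intro allI impI)
  fix \<epsilon> :: real assume "\<epsilon> > 0"
  then obtain c where c: "c \<in> Linf_circle" "approximable c" "sum_norm (\<lambda>z. b z - c z) < \<epsilon> / 2"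
    using lim[of "\<epsilon> / 2"] by auto
  then obtain p where p: "p \<in> trig_polys" "sum_norm (\<lambda>z. c z - p z) < \<epsilon> / 2"
    unfolding approximable_def using \<open>\<epsilon> > 0\<close> half_gt_zero by blast
  have "sum_norm (\<lambda>z. (b z - c z) + (c z - p z)) \<le> sum_norm (\<lambda>z. b z - c z) + sum_norm (\<lambda>z. c z - p z)"
    by (intro sum_norm_triangle Linf_diff b c trig_polys_Linf p)
  with c p show "\<exists>p\<in>trig_polys. sum_norm (\<lambda>z. b z - p z) < \<epsilon>" by (intro bexI[of _ p]) auto
qed

lemma approximable_continuous:
  assumes "continuous_on unit_circle f"
  shows "approximable f"
  unfolding approximable_def
proof (intro allI impI)
  fix \<epsilon> :: real assume "\<epsilon> > 0"
  then obtain p where p: "p \<in> trig_polys" "\<forall>z\<in>unit_circle. norm (f z - p z) < \<epsilon> / 3"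
    using trig_polys_uniformly_dense[OF assms, of "\<epsilon> / 3"] by auto
  have "sum_norm (\<lambda>z. f z - p z) \<le> 2 * (\<epsilon> / 3)"
  proof (rule sum_norm_bound)
    show "AE z in circle_measure. norm (f z - p z) \<le> \<epsilon> / 3"
      by (rule AE_I2) (use p in \<open>simp add: less_imp_le\<close>)
  qed (use \<open>\<epsilon> > 0\<close> p assms in \<open>auto intro: Linf_diff continuous_Linf trig_polys_Linf\<close>)
  with \<open>\<epsilon> > 0\<close> p show "\<exists>p\<in>trig_polys. sum_norm (\<lambda>z. f z - p z) < \<epsilon>"
    by (intro bexI[of _ p]) auto
qed

text \<open>The error is dominated by the indicator of a set of small measure. That is small in L^1
  at once and small in \<alpha> by continuity of the norm, hence the threshold
  \<open>min \<delta> (\<epsilon> / 2)\<close>.\<close>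

lemma approximable_indicator:
  assumes A: "A \<in> sets circle_measure"
  shows "approximable (indicator A)"
proof (rule approximable_limit[OF Linf_indicator[OF A]])
  fix \<epsilon> :: real assume "\<epsilon> > 0"
  obtain \<delta> where \<delta>: "\<delta> > 0"
    "\<And>E. E \<in> sets circle_measure \<Longrightarrow> measure circle_measure E < \<delta> \<Longrightarrow> \<alpha> (indicator E) < \<epsilon> / 2"
    using indicator_small[of "\<epsilon> / 2"] \<open>\<epsilon> > 0\<close> by auto
  obtain E and f :: "complex \<Rightarrow> real" where E: "E \<in> sets circle_measure"
    "measure circle_measure E < min \<delta> (\<epsilon> / 2)" and f: "continuous_on UNIV f"
    "\<And>z. z \<in> unit_circle \<Longrightarrow> \<bar>indicator A z - f z\<bar> \<le> indicator E z"
    using circle_measurable_squeeze[OF A, of "min \<delta> (\<epsilon> / 2)"] \<delta>(1) \<open>\<epsilon> > 0\<close> by auto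
  let ?f = "\<lambda>z. complex_of_real (f z)"
  have cont: "continuous_on unit_circle ?f"
    using f(1) by (intro continuous_intros) (auto intro: continuous_on_subset)
  have fl: "?f \<in> Linf_circle" by (rule continuous_Linf[OF cont])
  have "sum_norm (\<lambda>z. indicator A z - ?f z) \<le> sum_norm (indicator E)"
  proof (rule sum_norm_mono)
    show "AE z in circle_measure. norm (indicator A z - ?f z) \<le> norm (indicator E z :: complex)"
    proof (rule AE_I2)
      fix z assume "z \<in> space circle_measure"
      then have "\<bar>indicator A z - f z\<bar> \<le> indicator E z" using f(2) by simp
      moreover have "indicator A z - ?f z = of_real (indicator A z - f z)"
        by (simp add: indicator_def)
      moreover have "norm (indicator E z :: complex) = indicator E z"
        by (simp add: indicator_def)
      ultimately show "norm (indicator A z - ?f z) \<le> norm (indicator E z :: complex)"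
        by (simp only: norm_of_real)
    qed
  qed (intro Linf_diff Linf_indicator A E fl)+
  also have "\<dots> = \<alpha> (indicator E) + measure circle_measure E"
  proof -
    have "norm (indicator E z :: complex) = indicator E z" for z by (simp add: indicator_def)
    then show ?thesis
      using sets.sets_into_space[OF E(1)] by (simp add: sum_norm_def Int_absorb2)
  qed
  also have "\<dots> < \<epsilon>" using \<delta>(2)[OF E(1)] E(2) by simp
  finally show "\<exists>c\<in>Linf_circle. approximable c \<and> sum_norm (\<lambda>z. indicator A z - c z) < \<epsilon>"
    using fl approximable_continuous[OF cont] by blast
qed

lemma approximable_add:
  assumes "b \<in> Linf_circle" "c \<in> Linf_circle" "approximable b" "approximable c"
  shows "approximable (\<lambda>z. b z + c z)"
  unfolding approximable_def
proof (intro allI impI)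
  fix \<epsilon> :: real assume "\<epsilon> > 0"
  then obtain p q where p: "p \<in> trig_polys" "sum_norm (\<lambda>z. b z - p z) < \<epsilon> / 2"
    and q: "q \<in> trig_polys" "sum_norm (\<lambda>z. c z - q z) < \<epsilon> / 2"
    using assms(3,4) unfolding approximable_def by (metis half_gt_zero)
  have "sum_norm (\<lambda>z. (b z - p z) + (c z - q z)) \<le> sum_norm (\<lambda>z. b z - p z) + sum_norm (\<lambda>z. c z - q z)"
    by (intro sum_norm_triangle Linf_diff assms trig_polys_Linf p q)
  with p q show "\<exists>p\<in>trig_polys. sum_norm (\<lambda>z. b z + c z - p z) < \<epsilon>"
    by (intro bexI[OF _ trig_polys.add[OF p(1) q(1)]]) (simp add: algebra_simps)
qed

lemma approximable_cmult:
  assumes "b \<in> Linf_circle" "approximable b"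
  shows "approximable (\<lambda>z. c * b z)"
  unfolding approximable_def
proof (intro allI impI)
  fix \<epsilon> :: real assume "\<epsilon> > 0"
  then have "\<epsilon> / (norm c + 1) > 0" by (simp add: add_nonneg_pos)
  then obtain p where p: "p \<in> trig_polys" "sum_norm (\<lambda>z. b z - p z) < \<epsilon> / (norm c + 1)"
    using assms(2) unfolding approximable_def by blast
  have d: "(\<lambda>z. b z - p z) \<in> Linf_circle" by (intro Linf_diff assms trig_polys_Linf p)
  have "sum_norm (\<lambda>z. c * b z - c * p z) = norm c * sum_norm (\<lambda>z. b z - p z)"
    using sum_norm_scale[OF d] by (simp add: right_diff_distrib)
  also have "\<dots> \<le> (norm c + 1) * sum_norm (\<lambda>z. b z - p z)"
    using sum_norm_nonneg[OF d] by (simp add: distrib_right)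
  also have "\<dots> < \<epsilon>" using p(2) by (simp add: pos_less_divide_eq add_nonneg_pos mult.commute)
  finally show "\<exists>p\<in>trig_polys. sum_norm (\<lambda>z. c * b z - p z) < \<epsilon>"
    by (intro bexI[OF _ trig_polys_cmult[OF p(1)]])
qed

text \<open>Values off the circle are invisible to \<open>sum_norm\<close>; the representation of a
  simple function by indicators is needed on the circle only.\<close>

lemma approximable_cong:
  assumes "\<And>z. z \<in> unit_circle \<Longrightarrow> b z = c z" "b \<in> Linf_circle" "c \<in> Linf_circle" "approximable b"
  shows "approximable c"
proof (rule approximable_limit[OF assms(3)])
  fix \<epsilon> :: real assume "\<epsilon> > 0"
  have "sum_norm (\<lambda>z. c z - b z) \<le> 2 * 0"
    using assms(1) by (intro sum_norm_bound Linf_diff assms AE_I2) auto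
  then show "\<exists>b\<in>Linf_circle. approximable b \<and> sum_norm (\<lambda>z. c z - b z) < \<epsilon>"
    using assms \<open>\<epsilon> > 0\<close> by (intro bexI[of _ b]) auto
qed

lemma approximable_simple:
  assumes s: "simple_function circle_measure s"
  shows "approximable s"
proof -
  let ?A = "\<lambda>y. s -` {y} \<inter> space circle_measure"
  have A: "?A y \<in> sets circle_measure" for y using simple_functionD(2)[OF s] by simp
  have l: "(\<lambda>z. y * indicator (?A y) z) \<in> Linf_circle" for y by (intro Linf_cmult Linf_indicator A)
  have "finite Y \<Longrightarrow> approximable (\<lambda>z. \<Sum>y\<in>Y. y * indicator (?A y) z)" for Y
  proof (induction Y rule: finite_induct)
    case empty
    show ?case using approximable_continuous[OF continuous_on_const[of _ 0]] by simp
  next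
    case (insert y Y)
    have "approximable (\<lambda>z. y * indicator (?A y) z + (\<Sum>y\<in>Y. y * indicator (?A y) z))"
      by (intro approximable_add approximable_cmult approximable_indicator A Linf_indicator l
        Linf_sum insert.IH)
    then show ?case using insert.hyps by (simp only: sum.insert simp_thms)
  qed
  from this[OF simple_functionD(1)[OF s]] show ?thesis
  proof (rule approximable_cong[rotated 3])
    fix z assume "z \<in> unit_circle"
    then show "(\<Sum>y\<in>s ` space circle_measure. y * indicator (?A y) z) = s z"
      using simple_function_indicator_representation_banach[OF s, of z]
      by (simp only: space_circle scaleR_conv_of_real of_real_indicator mult.commute)
  qed (intro Linf_sum l simple_function_Linf s)+
qed

lemma approximable_Linf:
  assumes b: "b \<in> Linf_circle"
  shows "approximable b"
proof (rule approximable_limit[OF b])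
  fix \<epsilon> :: real assume "\<epsilon> > 0"
  have [measurable]: "b \<in> borel_measurable circle_measure" by (rule Linf_measurable[OF b])
  obtain C where C: "C > 0" "AE z in circle_measure. norm (b z) \<le> C" using Linf_bounded[OF b] .
  \<comment> \<open>An error \<epsilon>/5 in each of the real and imaginary parts gives
    2\<epsilon>/5 in modulus and 4\<epsilon>/5 in \<open>sum_norm\<close>.\<close>
  have approx: "\<exists>s. simple_function circle_measure s \<and>
      (AE z in circle_measure. \<bar>v (b z) - s z\<bar> \<le> \<epsilon> / 5)"
    if v: "v \<in> borel_measurable borel" "\<And>w. \<bar>v w\<bar> \<le> norm w" for v :: "complex \<Rightarrow> real"
  proof -
    have [measurable]: "v \<in> borel_measurable borel" by fact
    \<comment> \<open>The clamp changes nothing a.e. but gives a bound valid at every point.\<close>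
    define u where "u z = max (- C) (min C (v (b z)))" for z
    obtain s where s: "simple_function circle_measure s" "\<And>z. s z \<le> u z" "\<And>z. u z \<le> s z + \<epsilon> / 5"
    proof (rule simple_function_floor_approx[of u circle_measure C "\<epsilon> / 5"])
      show "u \<in> borel_measurable circle_measure" unfolding u_def by measurable
    qed (use C(1) \<open>\<epsilon> > 0\<close> in \<open>auto simp: u_def\<close>)
    have "AE z in circle_measure. \<bar>v (b z) - s z\<bar> \<le> \<epsilon> / 5"
      using C(2)
    proof eventually_elim
      case (elim z)
      then have "u z = v (b z)" using v(2)[of "b z"] by (auto simp: u_def)
      then show ?case using s(2,3)[of z] by auto
    qed
    with s show ?thesis by blast
  qed
  obtain s t where s: "simple_function circle_measure s" "AE z in circle_measure. \<bar>Re (b z) - s z\<bar> \<le> \<epsilon> / 5"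
    and t: "simple_function circle_measure t" "AE z in circle_measure. \<bar>Im (b z) - t z\<bar> \<le> \<epsilon> / 5"
    using approx[of Re] approx[of Im] by (auto simp: abs_Re_le_cmod abs_Im_le_cmod)
  define c where "c z = Complex (s z) (t z)" for z
  have c: "simple_function circle_measure c"
    unfolding c_def by (rule simple_function_compose2[OF s(1) t(1)])
  have cl: "c \<in> Linf_circle" by (rule simple_function_Linf[OF c])
  have "sum_norm (\<lambda>z. b z - c z) \<le> 2 * (2 * \<epsilon> / 5)"
  proof (rule sum_norm_bound)
    show "AE z in circle_measure. norm (b z - c z) \<le> 2 * \<epsilon> / 5"
      using s(2) t(2)
    proof eventually_elim
      case (elim z)
      then show ?case using cmod_le[of "b z - c z"] by (simp add: c_def)
    qed
  qed (use \<open>\<epsilon> > 0\<close> in \<open>auto intro!: Linf_diff b cl\<close>)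
  then show "\<exists>c\<in>Linf_circle. approximable c \<and> sum_norm (\<lambda>z. b z - c z) < \<epsilon>"
    using cl approximable_simple[OF c] \<open>\<epsilon> > 0\<close> by (intro bexI[of _ c]) auto
qed

end

section \<open>Fejer means\<close>

text \<open>A frequency k with |k| \<le> n arises from n - |k| pairs (a, b), so for positive n this
  is the usual mean with weights 1 - |k|/n. The double sum matches the expansion of the squared
  modulus in \<open>fejer_kernel\<close>.\<close>

definition fejer :: "nat \<Rightarrow> (complex \<Rightarrow> complex) \<Rightarrow> complex \<Rightarrow> complex" where
  "fejer n h z =
    (\<Sum>a<n. \<Sum>b<n. fcoeff h (int a - int b) * z powi (int a - int b)) / of_nat n"

lemma fejer_add:
  "integrable circle_measure h \<Longrightarrow> integrable circle_measure k \<Longrightarrow>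
    fejer n (\<lambda>z. h z + k z) z = fejer n h z + fejer n k z"
  by (simp add: fejer_def fcoeff_add distrib_right sum.distrib add_divide_distrib)

lemma fejer_diff:
  "integrable circle_measure h \<Longrightarrow> integrable circle_measure k \<Longrightarrow>
    fejer n (\<lambda>z. h z - k z) z = fejer n h z - fejer n k z"
  by (simp add: fejer_def fcoeff_diff left_diff_distrib sum_subtractf diff_divide_distrib)

lemma fejer_cmult: "fejer n (\<lambda>z. c * h z) z = c * fejer n h z"
  by (simp add: fejer_def fcoeff_cmult mult.assoc sum_distrib_left)

lemma fejer_Linf: "fejer n h \<in> Linf_circle"
proof -
  have "(\<lambda>z. (1 / of_nat n) * (\<Sum>a<n. \<Sum>b<n. fcoeff h (int a - int b) * z powi (int a - int b))) \<in> Linf_circle"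
    by (intro Linf_cmult Linf_sum Linf_powi)
  then show ?thesis by (simp add: fejer_def[abs_def])
qed

text \<open>There are n^2 terms, each at most the L^1 norm, divided by n. Crude as it is, for fixed
  n it turns L^1 smallness into uniform smallness.\<close>

lemma norm_fejer_le:
  assumes "integrable circle_measure h" "norm z = 1"
  shows "norm (fejer n h z) \<le> real n * (LINT z|circle_measure. norm (h z))"
proof -
  let ?I = "LINT z|circle_measure. norm (h z)"
  have "norm (\<Sum>a<n. \<Sum>b<n. fcoeff h (int a - int b) * z powi (int a - int b)) \<le> (\<Sum>a<n. \<Sum>b<n. ?I)"
    using assms by (intro sum_norm_le) (simp add: norm_mult norm_powi_circle norm_fcoeff_le)
  then show ?thesis
    by (cases "n = 0") (auto simp: fejer_def norm_divide field_simps power2_eq_square)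
qed

lemma fejer_analytic_poly:
  assumes "\<And>k. k < 0 \<Longrightarrow> fcoeff h k = 0"
  shows "fejer n h \<in> analytic_polys"
proof -
  \<comment> \<open>The guard \<open>b \<le> a\<close> is essential: truncated subtraction would
    otherwise send every pair with a < b to the coefficient of index 0.\<close>
  define c where "c k = (\<Sum>a<n. \<Sum>b<n. if b \<le> a \<and> k = a - b then fcoeff h (int a - int b) else 0) / of_nat n" for k
  have expand: "(if b \<le> a then fcoeff h (int a - int b) * z ^ (a - b) else 0) =
      (\<Sum>k\<le>n. (if b \<le> a \<and> k = a - b then fcoeff h (int a - int b) else 0) * z ^ k)" if "a < n" for a b z
    using that less_imp_diff_less[OF that, of b]
    by (auto simp: if_distrib[of "\<lambda>x. x * _"] sum.delta cong: if_cong)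
  have "fejer n h z = (\<Sum>k\<le>n. c k * z ^ k)" for z
  proof -
    have "fcoeff h (int a - int b) * z powi (int a - int b) =
        (if b \<le> a then fcoeff h (int a - int b) * z ^ (a - b) else 0)" for a b
      using assms[of "int a - int b"] by (auto simp flip: of_nat_diff)
    then have "fejer n h z = (\<Sum>a<n. \<Sum>b<n. \<Sum>k\<le>n.
        (if b \<le> a \<and> k = a - b then fcoeff h (int a - int b) else 0) * z ^ k) / of_nat n"
      by (simp add: fejer_def expand)
    also have "\<dots> = (\<Sum>k\<le>n. c k * z ^ k)"
      by (simp add: c_def sum_divide_distrib sum_distrib_right sum.swap[of _ "{..n}"])
    finally show ?thesis .
  qed
  then show ?thesis unfolding analytic_polys_def by blast
qed

text \<open>Counts lattice points on a diagonal of an n by n square: for given a the only candidate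
  is b = a - k, admissible exactly when max 0 k \<le> a < min n (n + k).\<close>

lemma sum_indicator_diff_eq:
  assumes "\<bar>k\<bar> \<le> int n"
  shows "(\<Sum>a<n. \<Sum>b<n. if k = int a - int b then 1 else 0 :: complex) = of_int (int n - \<bar>k\<bar>)"
proof -
  have "(\<Sum>b<n. if k = int a - int b then 1 else 0 :: complex) =
      (if a \<in> {nat (max 0 k)..<nat (min (int n) (int n + k))} then 1 else 0)" if "a < n" for a
  proof -
    have "(\<Sum>b<n. if k = int a - int b then 1 else 0 :: complex) =
        (\<Sum>b<n. if b = nat (int a - k) \<and> int a - k \<ge> 0 then 1 else 0)"
      by (intro sum.cong) auto
    also have "\<dots> = (if int a - k \<ge> 0 \<and> int a - k < int n then 1 else 0)"
      by (cases "int a - k \<ge> 0") (auto simp: sum.delta)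
    also have "\<dots> = (if a \<in> {nat (max 0 k)..<nat (min (int n) (int n + k))} then 1 else 0)"
      using that by auto
    finally show ?thesis .
  qed
  then have "(\<Sum>a<n. \<Sum>b<n. if k = int a - int b then 1 else 0 :: complex) =
     (\<Sum>a<n. if a \<in> {nat (max 0 k)..<nat (min (int n) (int n + k))} then 1 else 0)"
    by (intro sum.cong) auto
  also have "\<dots> = (\<Sum>a\<in>{..<n} \<inter> {nat (max 0 k)..<nat (min (int n) (int n + k))}. 1)"
    by (simp only: sum.inter_restrict[OF finite_lessThan])
  also have "{..<n} \<inter> {nat (max 0 k)..<nat (min (int n) (int n + k))} =
     {nat (max 0 k)..<nat (min (int n) (int n + k))}"
    by auto
  also have "(\<Sum>a\<in>\<dots>. 1 :: complex) = of_int (int n - \<bar>k\<bar>)"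
    using assms by (cases "k \<ge> 0") (auto simp: nat_diff_distrib of_nat_diff max_def min_def abs_if)
  finally show ?thesis .
qed

lemma fejer_powi:
  assumes "n > 0" "\<bar>k\<bar> \<le> int n"
  shows "fejer n (\<lambda>z. z powi k) z = of_real (1 - of_int \<bar>k\<bar> / real n) * z powi k"
proof -
  have "(\<Sum>a<n. \<Sum>b<n. fcoeff (\<lambda>z. z powi k) (int a - int b) * z powi (int a - int b)) =
     (\<Sum>a<n. \<Sum>b<n. (if k = int a - int b then 1 else 0) * z powi k)"
    by (intro sum.cong refl) (auto simp: fcoeff_powi)
  also have "\<dots> = of_int (int n - \<bar>k\<bar>) * z powi k"
    unfolding sum_indicator_diff_eq[OF assms(2), symmetric] by (simp add: sum_distrib_right)
  finally have "fejer n (\<lambda>z. z powi k) z = of_int (int n - \<bar>k\<bar>) * z powi k / of_nat n"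
    by (simp only: fejer_def)
  also have "of_int (int n - \<bar>k\<bar>) = complex_of_real (real n - of_int \<bar>k\<bar>)"
    by (simp del: of_int_abs)
  finally show ?thesis using assms(1) by (simp add: diff_divide_distrib left_diff_distrib)
qed

lemma fejer_trig_poly_converges:
  assumes "q \<in> trig_polys" "e > 0"
  shows "eventually (\<lambda>n. \<forall>z\<in>unit_circle. norm (fejer n q z - q z) < e) sequentially"
  using assms
proof (induction arbitrary: e rule: trig_polys.induct)
  case (monom c k)
  have "(\<lambda>n. norm c * (of_int \<bar>k\<bar> / real n)) \<longlonglongrightarrow> norm c * 0"
    by (intro tendsto_mult tendsto_const lim_const_over_n)
  then have "eventually (\<lambda>n. norm c * (of_int \<bar>k\<bar> / real n) < e) sequentially"
    using monom by (intro order_tendstoD) auto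
  then show ?case
    \<comment> \<open>The successor ensures n > 0 even for k = 0; then the relative error on the
      monomial is exactly |k|/n.\<close>
    using eventually_ge_at_top[of "Suc (nat \<bar>k\<bar>)"]
  proof eventually_elim
    case (elim n)
    show ?case
    proof
      fix z assume "z \<in> unit_circle"
      have "fejer n (\<lambda>z. c * z powi k) z - c * z powi k = - of_real (of_int \<bar>k\<bar> / real n) * (c * z powi k)"
        using elim(2) by (simp add: fejer_cmult fejer_powi algebra_simps)
      also have "norm \<dots> = norm c * (of_int \<bar>k\<bar> / real n)"
        using \<open>z \<in> unit_circle\<close>
        by (simp add: norm_mult norm_powi_circle unit_circle_iff norm_divide)
      finally show "norm (fejer n (\<lambda>z. c * z powi k) z - c * z powi k) < e" using elim(1) by simp
    qed
  qed
next
  case (add p q)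
  have "eventually (\<lambda>n. \<forall>z\<in>unit_circle. norm (fejer n p z - p z) < e / 2) sequentially"
    "eventually (\<lambda>n. \<forall>z\<in>unit_circle. norm (fejer n q z - q z) < e / 2) sequentially"
    using add.IH[of "e / 2"] add.prems by (simp_all only: half_gt_zero)
  then show ?case
  proof eventually_elim
    case (elim n)
    show ?case
    proof
      fix z assume "z \<in> unit_circle"
      then have "norm ((fejer n p z - p z) + (fejer n q z - q z)) < e"
        using elim by (metis norm_triangle_lt add_strict_mono field_sum_of_halves)
      then show "norm (fejer n (\<lambda>z. p z + q z) z - (p z + q z)) < e"
        using add.hyps by (simp add: fejer_add Linf_integrable trig_polys_Linf algebra_simps)
    qed
  qed
qed

section \<open>Fejer means as finite averages over roots of unity\<close>

lemma sum_roots_of_unity_powi: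
  assumes "\<bar>m\<bar> < int N"
  shows "(\<Sum>j<N. cis (2 * pi * real j / real N) powi m) = (if m = 0 then of_nat N else 0)"
proof (cases "m = 0")
  case False
  have N: "N > 0" using assms by (cases N) auto
  define x where "x = cis (2 * pi * of_int m / real N)"
  \<comment> \<open>The sum is geometric with ratio \<open>x\<close>, an N-th root of unity;
    \<open>x = 1\<close> would make N divide the nonzero m, against |m| < N.\<close>
  have "x \<noteq> 1"
  proof
    assume "x = 1"
    then obtain l :: int where "2 * pi * of_int m / real N = of_int l * (2 * pi)"
      unfolding x_def cis_eq_1_iff by blast
    then have "real_of_int m = of_int l * real N" using N by (simp add: field_simps)
    then have "m = l * int N" by (metis of_int_eq_iff of_int_mult of_int_of_nat_eq)
    then have "int N dvd m" by simp
    then have "int N \<le> \<bar>m\<bar>" using False by (metis abs_of_nat dvd_imp_le_int)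
    then show False using assms by simp
  qed
  moreover have "x ^ N = 1"
    using N cis_multiple_2pi[of "of_int m"] by (simp add: x_def Complex.DeMoivre)
  moreover have "cis (2 * pi * real j / real N) powi m = x ^ j" for j
    by (simp add: x_def cis_powi Complex.DeMoivre mult_ac)
  ultimately show ?thesis using False by (simp add: geometric_sum)
qed simp

text \<open>For n > 0 and w on the circle this is the sum of (1 - |k|/n) w^k over |k| < n. The
  squared modulus makes its positivity evident, so its values can serve as weights.\<close>

definition fejer_kernel :: "nat \<Rightarrow> complex \<Rightarrow> real" where
  "fejer_kernel n w = (norm (\<Sum>a<n. w ^ a))\<^sup>2 / real n"

lemma fejer_kernel_nonneg: "0 \<le> fejer_kernel n w"
  by (simp add: fejer_kernel_def)

lemma fejer_kernel_expand:
  assumes "norm w = 1"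
  shows "of_real (fejer_kernel n w) = (\<Sum>a<n. \<Sum>b<n. w powi (int a - int b)) / of_nat n"
proof -
  have "w ^ a * cnj w ^ b = w powi (int a - int b)" for a b
    using powi_mult_circle[OF assms, of "int a" "- int b"]
    by (simp add: cnj_circle[OF assms] power_int_minus power_inverse)
  moreover have "of_real ((norm (\<Sum>a<n. w ^ a))\<^sup>2) = (\<Sum>a<n. \<Sum>b<n. w ^ a * cnj w ^ b)"
    by (simp only: complex_norm_square cnj_sum complex_cnj_power sum_product)
  ultimately show ?thesis by (simp add: fejer_kernel_def)
qed

text \<open>For a trigonometric polynomial, averaging over the N-th roots of unity with N large computes
  the convolution with the Fejer kernel exactly.\<close>

lemma fejer_discrete:
  assumes "q \<in> trig_polys"
  shows "eventually (\<lambda>N. \<forall>z\<in>unit_circle. fejer n q z =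
    (\<Sum>j<N. of_real (fejer_kernel n (cis (2 * pi * real j / real N)) / real N) *
      q (cnj (cis (2 * pi * real j / real N)) * z))) sequentially"
  using assms
proof (induction rule: trig_polys.induct)
  case (monom c k)
  show ?case
    \<comment> \<open>Since |a - b| < n, every frequency a - b - k is below N in modulus, so the
      N-th roots detect precisely the pairs with a - b = k.\<close>
    using eventually_gt_at_top[of "n + nat \<bar>k\<bar>"]
  proof eventually_elim
    case (elim N)
    show ?case
    proof
      fix z assume z: "z \<in> unit_circle"
      let ?w = "\<lambda>j. cis (2 * pi * real j / real N)"
      have "(\<Sum>j<N. of_real (fejer_kernel n (?w j) / real N) * (c * (cnj (?w j) * z) powi k)) =
         (\<Sum>j<N. \<Sum>a<n. \<Sum>b<n. (c * z powi k / (of_nat n * of_nat N)) * ?w j powi (int a - int b - k))"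
      proof (intro sum.cong refl)
        fix j
        have "(cnj (?w j)) powi k = ?w j powi (- k)"
          by (simp add: cis_powi cis_cnj)
        then show "of_real (fejer_kernel n (?w j) / real N) * (c * (cnj (?w j) * z) powi k) =
           (\<Sum>a<n. \<Sum>b<n. (c * z powi k / (of_nat n * of_nat N)) * ?w j powi (int a - int b - k))"
          using powi_mult_circle[of "?w j" "int a - int b" "- k" for a b, symmetric]
          by (simp add: fejer_kernel_expand power_int_mult_distrib sum_distrib_left sum_distrib_right
            sum_divide_distrib mult_ac)
      qed
      also have "\<dots> = (\<Sum>a<n. \<Sum>b<n. \<Sum>j<N.
          (c * z powi k / (of_nat n * of_nat N)) * ?w j powi (int a - int b - k))"
        by (simp only: sum.swap[of _ _ "{..<N}"])
      also have "\<dots> = (\<Sum>a<n. \<Sum>b<n. (c * z powi k / (of_nat n * of_nat N)) *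
          (if int a - int b - k = 0 then of_nat N else 0))"
      proof (intro sum.cong refl)
        fix a b assume "a \<in> {..<n}" "b \<in> {..<n}"
        then have "\<bar>int a - int b - k\<bar> < int N" using elim by auto
        from sum_roots_of_unity_powi[OF this] show "(\<Sum>j<N.
          (c * z powi k / (of_nat n * of_nat N)) * ?w j powi (int a - int b - k)) =
          (c * z powi k / (of_nat n * of_nat N)) * (if int a - int b - k = 0 then of_nat N else 0)"
          by (simp only: sum_distrib_left[symmetric])
      qed
      also have "\<dots> = fejer n (\<lambda>z. c * z powi k) z"
        unfolding fejer_def fcoeff_cmult fcoeff_powi sum_divide_distrib
        using elim by (intro sum.cong refl) auto
      finally show "fejer n (\<lambda>z. c * z powi k) z =
        (\<Sum>j<N. of_real (fejer_kernel n (?w j) / real N) * (c * (cnj (?w j) * z) powi k))" by simp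
    qed
  qed
next
  case (add p q)
  from add.IH show ?case
    by eventually_elim
      (simp add: fejer_add Linf_integrable trig_polys_Linf add.hyps distrib_left sum.distrib)
qed

lemma trig_polys_continuous: "p \<in> trig_polys \<Longrightarrow> continuous_on unit_circle p"
  by (induction rule: trig_polys.induct) (intro continuous_intros continuous_powi; assumption)+

lemma trig_polys_rotate_Linf:
  assumes "p \<in> trig_polys" "w \<in> unit_circle"
  shows "(\<lambda>z. p (cnj w * z)) \<in> Linf_circle"
proof (rule continuous_Linf, rule continuous_on_compose2[OF trig_polys_continuous[OF assms(1)]])
  show "(\<lambda>z. cnj w * z) ` unit_circle \<subseteq> unit_circle"
    using assms(2) by (auto simp: unit_circle_iff norm_mult)
qed (intro continuous_intros)

section \<open>Simultaneous approximation in L^\<alpha> and L^1, and convergence of Fejer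
  means\<close>

context rot_sym_norm
begin

lemma fejer_contraction:
  assumes q: "q \<in> trig_polys" and "n > 0"
  shows "\<alpha> (fejer n q) \<le> \<alpha> q"
proof -
  let ?w = "\<lambda>N j. cis (2 * pi * real j / real N)"
  let ?k = "\<lambda>N j. fejer_kernel n (?w N j) / real N"
  \<comment> \<open>One N serves both \<open>q\<close> and the constant 1; the identity for the
    constant, evaluated at 1, shows that the weights sum to 1.\<close>
  obtain N where N: "\<forall>z\<in>unit_circle. fejer n q z = (\<Sum>j<N. of_real (?k N j) * q (cnj (?w N j) * z))"
    "\<forall>z\<in>unit_circle. fejer n (\<lambda>z. 1 * z powi 0) z = (\<Sum>j<N. of_real (?k N j) * (1 * (cnj (?w N j) * z) powi 0))"
    using eventually_happens[OF eventually_conj[OF fejer_discrete[OF q, of n]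
      fejer_discrete[OF trig_polys.monom[of 1 0], of n]]] by auto
  have "complex_of_real (\<Sum>j<N. ?k N j) = fejer n (\<lambda>z. 1 * z powi 0) 1"
    using N(2) by (simp add: unit_circle_iff)
  also have "\<dots> = 1" using \<open>n > 0\<close> by (simp only: fejer_cmult fejer_powi) simp
  finally have sum1: "(\<Sum>j<N. ?k N j) = 1" by (simp only: of_real_eq_1_iff)
  have w: "?w N j \<in> unit_circle" for j by (simp add: unit_circle_iff)
  have rl: "(\<lambda>z. q (cnj (?w N j) * z)) \<in> Linf_circle" for j
    by (rule trig_polys_rotate_Linf[OF q w])
  have "\<alpha> (fejer n q) = \<alpha> (\<lambda>z. \<Sum>j<N. of_real (?k N j) * q (cnj (?w N j) * z))"
    using N(1) by (intro cong fejer_Linf Linf_sum Linf_cmult rl AE_I2) simp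
  also have "\<dots> \<le> (\<Sum>j<N. \<alpha> (\<lambda>z. of_real (?k N j) * q (cnj (?w N j) * z)))"
    by (intro sum_le Linf_cmult rl) simp
  also have "\<dots> = (\<Sum>j<N. ?k N j * \<alpha> q)"
    by (intro sum.cong refl, subst scale[OF rl])
      (simp add: rotate[OF w trig_polys_Linf[OF q]] fejer_kernel_nonneg norm_divide)
  also have "\<dots> = \<alpha> q" by (simp only: sum_distrib_right[symmetric] sum1 mult_1)
  finally show ?thesis .
qed

text \<open>The function g is truncated to 0 where |g| > k. The L^1 error is a tail integral. For
  the \<alpha> error a bounded b near g is used: on the small set E the function g is (g - b) + b,
  where g - b is small in \<alpha> everywhere and b costs at most a bound of |b| times the norm of
  the indicator of E.\<close>

lemma L_space_trig_approx:
  assumes g: "g \<in> L_space \<alpha>" "integrable circle_measure g" and "e > 0"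
  shows "\<exists>p\<in>trig_polys. norm_ext \<alpha> (\<lambda>z. g z - p z) < ennreal e \<and>
    (LINT z|circle_measure. norm (g z - p z)) < e"
proof -
  have [measurable]: "g \<in> borel_measurable circle_measure" using g(2) by auto
  have "0 < ennreal (e / 4)" using \<open>e > 0\<close> by simp
  then obtain b where b: "b \<in> Linf_circle" "norm_ext \<alpha> (\<lambda>z. g z - b z) < ennreal (e / 4)"
    using g(1) unfolding L_space_def by blast
  have [measurable]: "b \<in> borel_measurable circle_measure" by (rule Linf_measurable[OF b(1)])
  obtain C where C: "C > 0" "AE z in circle_measure. norm (b z) \<le> C" using Linf_bounded[OF b(1)] .
  obtain \<delta> where \<delta>: "\<delta> > 0"
    "\<And>E. E \<in> sets circle_measure \<Longrightarrow> measure circle_measure E < \<delta> \<Longrightarrow> \<alpha> (indicator E) < e / 4 / C"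
    using indicator_small[of "e / 4 / C"] \<open>e > 0\<close> C(1) by auto
  define E where "E k = {z \<in> space circle_measure. real k < norm (g z)}" for k
  have [measurable]: "E k \<in> sets circle_measure" for k unfolding E_def by measurable
  have Elim: "(\<lambda>k. indicator (E k) z :: real) \<longlonglongrightarrow> 0" for z
  proof (rule tendsto_eventually)
    have "eventually (\<lambda>k. norm (g z) \<le> real k) sequentially"
      using filterlim_real_sequentially by (auto simp: filterlim_at_top)
    then show "eventually (\<lambda>k. indicator (E k) z = (0::real)) sequentially"
      by eventually_elim (auto simp: E_def indicator_def)
  qed
  \<comment> \<open>Each point leaves \<open>E k\<close> once k reaches |g z|, so dominated
    convergence makes both the measure of \<open>E k\<close> and the integral of |g| over it tend to
    0.\<close>
  have "(\<lambda>k. LINT z|circle_measure. indicator (E k) z :: real) \<longlonglongrightarrow> (LINT z|circle_measure. 0)"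
    by (rule integral_dominated_convergence[where w = "\<lambda>_. 1"])
      (use Elim in \<open>auto simp: indicator_le_1 abs_le_iff simp del: of_bool_eq\<close>)
  then have "(\<lambda>k. measure circle_measure (E k)) \<longlonglongrightarrow> 0"
    by (simp add: Int_absorb2 E_def subset_eq)
  then have ev1: "eventually (\<lambda>k. measure circle_measure (E k) < \<delta>) sequentially"
    using \<delta>(1) by (rule order_tendstoD)
  have "(\<lambda>k. LINT z|circle_measure. indicator (E k) z * norm (g z)) \<longlonglongrightarrow> (LINT z|circle_measure. 0)"
  proof (rule integral_dominated_convergence[where w = "\<lambda>z. norm (g z)"])
    show "AE z in circle_measure. (\<lambda>k. indicator (E k) z * norm (g z)) \<longlonglongrightarrow> 0"
      by (intro AE_I2 tendsto_mult_left_zero Elim)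
  qed (use g(2) in \<open>auto intro!: AE_I2 simp: indicator_def\<close>)
  then have ev2: "eventually (\<lambda>k. (LINT z|circle_measure. indicator (E k) z * norm (g z)) < e / 2) sequentially"
    using \<open>e > 0\<close> by (intro order_tendstoD) auto
  obtain k where k: "measure circle_measure (E k) < \<delta>"
    "(LINT z|circle_measure. indicator (E k) z * norm (g z)) < e / 2"
    using eventually_happens[OF eventually_conj[OF ev1 ev2]] by auto
  define t where "t z = (if real k < norm (g z) then 0 else g z)" for z
  have t: "t \<in> Linf_circle"
  proof (rule Linf_circleI)
    show "t \<in> borel_measurable circle_measure" unfolding t_def by measurable
    show "AE z in circle_measure. norm (t z) \<le> real k" by (simp add: t_def)
  qed
  have gt: "g z - t z = indicator (E k) z * g z" if "z \<in> unit_circle" for z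
    using that by (simp add: t_def E_def indicator_def)
  obtain p where p: "p \<in> trig_polys" "sum_norm (\<lambda>z. t z - p z) < e / 2"
    using approximable_Linf[OF t] \<open>e > 0\<close> unfolding approximable_def by (metis half_gt_zero)
  have tp: "(\<lambda>z. t z - p z) \<in> Linf_circle" by (intro Linf_diff t trig_polys_Linf p)
  have pm [measurable]: "p \<in> borel_measurable circle_measure" "t \<in> borel_measurable circle_measure"
    by (intro Linf_measurable trig_polys_Linf p t)+
  have p\<alpha>: "\<alpha> (\<lambda>z. t z - p z) < e / 2"
  proof -
    have "0 \<le> (LINT z|circle_measure. norm (t z - p z))" by simp
    then show ?thesis using p(2) unfolding sum_norm_def by linarith
  qed
  have p1: "(LINT z|circle_measure. norm (t z - p z)) < e / 2"
    using p(2) nonneg[OF tp] by (simp add: sum_norm_def)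
  have "norm_ext \<alpha> (\<lambda>z. g z - p z) = norm_ext \<alpha> (\<lambda>z. (g z - t z) + (t z - p z))" by simp
  also have "\<dots> \<le> norm_ext \<alpha> (\<lambda>z. g z - t z) + norm_ext \<alpha> (\<lambda>z. t z - p z)"
    by (rule norm_ext_add) auto
  also have "norm_ext \<alpha> (\<lambda>z. g z - t z) =
      norm_ext \<alpha> (\<lambda>z. indicator (E k) z * (g z - b z) + indicator (E k) z * b z)"
    by (intro norm_ext_cong AE_I2) (simp add: gt algebra_simps)
  also have "\<dots> \<le> norm_ext \<alpha> (\<lambda>z. indicator (E k) z * (g z - b z)) + norm_ext \<alpha> (\<lambda>z. indicator (E k) z * b z)"
    by (rule norm_ext_add) auto
  also have "norm_ext \<alpha> (\<lambda>z. indicator (E k) z * (g z - b z)) \<le> norm_ext \<alpha> (\<lambda>z. g z - b z)"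
    by (intro norm_ext_mono AE_I2) (simp add: indicator_def)
  also have "\<dots> \<le> ennreal (e / 4)" using b(2) by simp
  also have "norm_ext \<alpha> (\<lambda>z. indicator (E k) z * b z) \<le> norm_ext \<alpha> (\<lambda>z. of_real C * indicator (E k) z)"
    by (intro norm_ext_mono, use C(2) in eventually_elim) (use C(1) in \<open>auto simp: indicator_def\<close>)
  also have "\<dots> = ennreal (C * \<alpha> (indicator (E k)))"
    using C(1) by (subst norm_ext_Linf) (auto intro!: Linf_cmult Linf_indicator simp: scale Linf_indicator)
  also have "\<dots> \<le> ennreal (e / 4)"
    using \<delta>(2)[of "E k"] k(1) C(1) by (intro ennreal_leI) (simp add: field_simps)
  also have "norm_ext \<alpha> (\<lambda>z. t z - p z) = ennreal (\<alpha> (\<lambda>z. t z - p z))" by (rule norm_ext_Linf[OF tp])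
  also have "ennreal (e / 4) + ennreal (e / 4) + ennreal (\<alpha> (\<lambda>z. t z - p z)) =
      ennreal (e / 2 + \<alpha> (\<lambda>z. t z - p z))"
    using \<open>e > 0\<close> nonneg[OF tp] by (simp flip: ennreal_plus)
  also have "\<dots> < ennreal e"
    using p\<alpha> \<open>e > 0\<close> by (intro ennreal_lessI) auto
  finally have 1: "norm_ext \<alpha> (\<lambda>z. g z - p z) < ennreal e" by (simp add: add_right_mono add_mono)
  have it: "integrable circle_measure (\<lambda>z. norm (g z - t z))" "integrable circle_measure (\<lambda>z. norm (t z - p z))"
    using g(2) Linf_integrable[OF t] Linf_integrable[OF tp] by auto
  have "(LINT z|circle_measure. norm (g z - p z)) \<le>
      (LINT z|circle_measure. norm (g z - t z) + norm (t z - p z))"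
  proof (rule integral_mono)
    show "norm (g z - p z) \<le> norm (g z - t z) + norm (t z - p z)" for z
      using norm_triangle_ineq[of "g z - t z" "t z - p z"] by simp
  qed (use it g(2) Linf_integrable[OF trig_polys_Linf[OF p(1)]] in auto)
  also have "\<dots> = (LINT z|circle_measure. norm (g z - t z)) + (LINT z|circle_measure. norm (t z - p z))"
    using it by (rule Bochner_Integration.integral_add)
  also have "(LINT z|circle_measure. norm (g z - t z)) = (LINT z|circle_measure. indicator (E k) z * norm (g z))"
    by (intro Bochner_Integration.integral_cong refl) (simp add: gt norm_mult indicator_def)
  also have "\<dots> + (LINT z|circle_measure. norm (t z - p z)) < e" using k(2) p1 by simp
  finally show ?thesis using 1 p(1) by blast
qed

text \<open>The approximant is a Fejer mean of g itself, which is an analytic polynomial because the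
  negative coefficients of g vanish. The auxiliary p and q may have negative frequencies and serve
  only to estimate the error.\<close>

lemma L_space_inter_H1:
  assumes "g \<in> L_space \<alpha>" "g \<in> H1_space"
  shows "g \<in> H_space \<alpha>"
  unfolding H_space_def
proof (safe intro!: assms(1))
  fix \<epsilon> :: ennreal assume "0 < \<epsilon>"
  \<comment> \<open>Error budget: e for g - p, 2e for the mean of p - q, e for p minus its own mean,
    and e for the mean of g - q.\<close>
  obtain e where e: "e > 0" "ennreal (5 * e) < \<epsilon>"
  proof (cases \<epsilon>)
    case (real r)
    with \<open>0 < \<epsilon>\<close> show ?thesis by (intro that[of "r / 6"]) (auto intro: ennreal_lessI)
  next
    case top
    then show ?thesis by (intro that[of 1]) auto
  qed
  have gi: "integrable circle_measure g" using assms(2) by (simp add: H1_space_def)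
  have [measurable]: "g \<in> borel_measurable circle_measure" using gi by auto
  obtain p where p: "p \<in> trig_polys" "norm_ext \<alpha> (\<lambda>z. g z - p z) < ennreal e"
    using L_space_trig_approx[OF assms(1) gi e(1)] by blast
  obtain n where n: "\<forall>z\<in>unit_circle. norm (fejer n p z - p z) < e" "n > 0"
    using eventually_happens[OF eventually_conj[OF fejer_trig_poly_converges[OF p(1) e(1)]
      eventually_gt_at_top[of 0]]] by auto
  \<comment> \<open>Chosen after n: \<eta> \<le> e keeps p - q within 2e in \<alpha>, and n \<eta>
    \<le> e makes the mean of g - q at most e uniformly.\<close>
  define \<eta> where "\<eta> = min e (e / real n)"
  have \<eta>: "\<eta> > 0" "\<eta> \<le> e" "real n * \<eta> \<le> e" using e(1) n(2) by (auto simp: \<eta>_def min_def field_simps)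
  obtain q where q: "q \<in> trig_polys" "norm_ext \<alpha> (\<lambda>z. g z - q z) < ennreal \<eta>"
    "(LINT z|circle_measure. norm (g z - q z)) < \<eta>"
    using L_space_trig_approx[OF assms(1) gi \<eta>(1)] by blast
  note pl = trig_polys_Linf[OF p(1)] and ql = trig_polys_Linf[OF q(1)]
  note [measurable] = Linf_measurable[OF pl] Linf_measurable[OF ql] Linf_measurable[OF fejer_Linf]
  have pqt: "(\<lambda>z. p z - q z) \<in> trig_polys" by (rule trig_polys_diff[OF p(1) q(1)])
  have pi: "integrable circle_measure p" and qi: "integrable circle_measure q"
    by (intro Linf_integrable pl ql)+
  let ?s = "fejer n g"
  have "ennreal (\<alpha> (\<lambda>z. p z - q z)) = norm_ext \<alpha> (\<lambda>z. p z - q z)"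
    by (rule norm_ext_Linf[OF Linf_diff[OF pl ql], symmetric])
  also have "\<dots> = norm_ext \<alpha> (\<lambda>z. (p z - g z) + (g z - q z))" by simp
  also have "\<dots> \<le> norm_ext \<alpha> (\<lambda>z. p z - g z) + norm_ext \<alpha> (\<lambda>z. g z - q z)"
    by (rule norm_ext_add) auto
  also have "norm_ext \<alpha> (\<lambda>z. p z - g z) = norm_ext \<alpha> (\<lambda>z. g z - p z)"
    by (rule norm_ext_cong) (simp add: norm_minus_commute)
  also have "norm_ext \<alpha> (\<lambda>z. g z - p z) + norm_ext \<alpha> (\<lambda>z. g z - q z) \<le> ennreal e + ennreal \<eta>"
    using p(2) q(2) by (intro add_mono) auto
  also have "\<dots> \<le> ennreal (2 * e)" using e(1) \<eta> by (simp add: ennreal_leI flip: ennreal_plus)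
  finally have pq: "\<alpha> (\<lambda>z. p z - q z) \<le> 2 * e" using e(1) by (simp add: ennreal_le_iff)
  \<comment> \<open>Only the first summand is the mean of a trigonometric polynomial estimated by
    contraction; the other two are bounded uniformly, which bounds them in \<alpha>.\<close>
  have "\<alpha> (\<lambda>z. p z - ?s z) \<le> \<alpha> (\<lambda>z. fejer n (\<lambda>z. p z - q z) z + ((p z - fejer n p z) - fejer n (\<lambda>z. g z - q z) z))"
    by (simp add: fejer_diff pi qi gi)
  also have "\<dots> \<le> \<alpha> (fejer n (\<lambda>z. p z - q z)) + \<alpha> (\<lambda>z. (p z - fejer n p z) - fejer n (\<lambda>z. g z - q z) z)"
    by (intro triangle fejer_Linf Linf_diff pl)
  also have "\<alpha> (fejer n (\<lambda>z. p z - q z)) \<le> 2 * e"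
    using fejer_contraction[OF pqt n(2)] pq by simp
  also have "\<alpha> (\<lambda>z. (p z - fejer n p z) - fejer n (\<lambda>z. g z - q z) z) \<le> 2 * e"
  proof (rule le_bound)
    show "AE z in circle_measure. norm ((p z - fejer n p z) - fejer n (\<lambda>z. g z - q z) z) \<le> 2 * e"
    proof (rule AE_I2)
      fix z assume z: "z \<in> space circle_measure"
      have "norm (fejer n (\<lambda>z. g z - q z) z) \<le> real n * (LINT z|circle_measure. norm (g z - q z))"
        using z gi qi by (intro norm_fejer_le) (auto simp: unit_circle_iff)
      also have "\<dots> \<le> real n * \<eta>" using q(3) by (intro mult_left_mono) auto
      finally have "norm (fejer n (\<lambda>z. g z - q z) z) \<le> e" using \<eta> by simp
      moreover have "norm (p z - fejer n p z) \<le> e"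
        using n(1) z by (auto simp: norm_minus_commute less_imp_le)
      ultimately show "norm ((p z - fejer n p z) - fejer n (\<lambda>z. g z - q z) z) \<le> 2 * e"
        using norm_triangle_ineq4[of "p z - fejer n p z" "fejer n (\<lambda>z. g z - q z) z"] by simp
    qed
  qed (use e(1) in \<open>auto intro!: fejer_Linf Linf_diff pl\<close>)
  finally have main: "\<alpha> (\<lambda>z. p z - ?s z) \<le> 4 * e" by simp
  have "norm_ext \<alpha> (\<lambda>z. g z - ?s z) = norm_ext \<alpha> (\<lambda>z. (g z - p z) + (p z - ?s z))" by simp
  also have "\<dots> \<le> norm_ext \<alpha> (\<lambda>z. g z - p z) + norm_ext \<alpha> (\<lambda>z. p z - ?s z)"
    by (rule norm_ext_add) auto
  also have "norm_ext \<alpha> (\<lambda>z. p z - ?s z) = ennreal (\<alpha> (\<lambda>z. p z - ?s z))"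
    by (intro norm_ext_Linf Linf_diff pl fejer_Linf)
  also have "\<dots> \<le> ennreal (4 * e)" using main by (rule ennreal_leI)
  also have "norm_ext \<alpha> (\<lambda>z. g z - p z) \<le> ennreal e"
    using p(2) by simp
  also have "ennreal e + ennreal (4 * e) = ennreal (5 * e)" using e(1) by (simp flip: ennreal_plus)
  also note e(2)
  finally have "norm_ext \<alpha> (\<lambda>z. g z - ?s z) < \<epsilon>" by (simp add: add_left_mono add_right_mono)
  moreover have "?s \<in> analytic_polys"
    using fcoeff_H1[OF assms(2)] by (rule fejer_analytic_poly)
  ultimately show "\<exists>p\<in>analytic_polys. norm_ext \<alpha> (\<lambda>z. g z - p z) < \<epsilon>" by blast
qed

end

text \<open>\<open>norm_ext\<close> depends on the modulus a.e. only, and f - b = \<phi> (g - cnj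
  \<phi> b) a.e.; so a bounded approximant b of f becomes the bounded approximant cnj \<phi> b of g
  with the same error.\<close>

lemma L_space_unimodular_divide:
  assumes f: "f \<in> L_space \<alpha>" and \<phi>: "\<phi> \<in> Linf_circle" "AE z in circle_measure. norm (\<phi> z) = 1"
    and g: "g \<in> borel_measurable circle_measure" and fg: "AE z in circle_measure. f z = \<phi> z * g z"
  shows "g \<in> L_space \<alpha>"
  unfolding L_space_def Lcal_space_def
proof (safe intro!: g)
  have "norm_ext \<alpha> g = norm_ext \<alpha> f"
    by (rule norm_ext_cong, use \<phi>(2) fg in eventually_elim) (simp add: norm_mult)
  then show "norm_ext \<alpha> g < \<infinity>" using f by (simp add: L_space_def Lcal_space_def)
  fix \<epsilon> :: ennreal assume "0 < \<epsilon>"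
  then obtain b where b: "b \<in> Linf_circle" "norm_ext \<alpha> (\<lambda>z. f z - b z) < \<epsilon>"
    using f by (auto simp: L_space_def)
  have "norm_ext \<alpha> (\<lambda>z. g z - cnj (\<phi> z) * b z) = norm_ext \<alpha> (\<lambda>z. f z - b z)"
  proof (rule norm_ext_cong, use \<phi>(2) fg in eventually_elim)
    case (elim z)
    have "f z - b z = \<phi> z * (g z - cnj (\<phi> z) * b z)"
      using elim by (simp add: right_diff_distrib complex_norm_square[symmetric] flip: mult.assoc)
    then show ?case using elim by (simp add: norm_mult)
  qed
  with b show "\<exists>b\<in>Linf_circle. norm_ext \<alpha> (\<lambda>z. g z - b z) < \<epsilon>"
    using Linf_mult[OF Linf_cnj[OF \<phi>(1)] b(1)] by (intro bexI[of _ "\<lambda>z. cnj (\<phi> z) * b z"]) auto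
qed

theorem corollary8p2:
  fixes \<alpha> :: "(complex \<Rightarrow> complex) \<Rightarrow> real" and f \<phi> g :: "complex \<Rightarrow> complex"
  assumes "cont_rot_sym_norm \<alpha>"
    and "f \<in> H_space \<alpha>"
    and "inner_function \<phi>"
    and "g \<in> H1_space" and "outer_function g"
    and "AE z in circle_measure. f z = \<phi> z * g z"
  shows "g \<in> H_space \<alpha>"
proof -
  interpret rot_sym_norm \<alpha> by standard fact
  have "g \<in> L_space \<alpha>"
    by (rule L_space_unimodular_divide[of f \<alpha> \<phi>])
      (use assms in \<open>auto simp: H_space_def inner_function_def Hinf_space_def H1_space_def\<close>)
  then show ?thesis using assms(4) by (rule L_space_inter_H1)
qed

end
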